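(* Let $C$ be a finite set. Then the geometric realisation $\|F(C)^\bullet\|$ is homotopy equivalent to a wedge of $(|C|-1)$-spheres.
   Context: $F(C)^\bullet$ is the semi-simplicial set whose $i$-simplices are the ordered subsets of $C$ of cardinality $i+1$ (i.e. $(i+1)$-tuples of pairwise distinct elements of $C$), with $j$-th face map given by forgetting the $j$-th element; it is known as the complex of injective words. A semi-simplicial set is a functor $X_\bullet$ to sets from the opposite of the category of finite ordered sets $[n]=\{0,\dots,n\}$ and strictly monotone maps, and its realisation is $\|X_\bullet\|=\coprod_n X_n\times\Delta^n/\sim$ with $(d_i x,y)\sim(x,d^i y)$. A wedge may be empty (a point), and the empty space is regarded as the $(-1)$-sphere when $C=\emptyset$. *)

theory Defs
  imports "HOL-Homology.Homology"
begin

section \<open>Semi-simplicial sets\<close>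

text \<open>
  The finite ordered set $[n]$ is \<^term>\<open>{..n}\<close>.  Morphisms are extensional functions,
  so that equality of functions is equality of morphisms.
\<close>

definition strict_maps :: "nat \<Rightarrow> nat \<Rightarrow> (nat \<Rightarrow> nat) set" where
  "strict_maps m n = {\<theta> \<in> {..m} \<rightarrow>\<^sub>E {..n}. strict_mono_on {..m} \<theta>}"

text \<open>
  If $\theta : [m] \to [n]$ is strictly monotone, then \<open>pull X m n \<theta>\<close> is the
  induced map $X_n \to X_m$; its values outside $X_n$ are irrelevant.
\<close>

record 'a ssset =
  simplices :: "nat \<Rightarrow> 'a set"
  pull :: "nat \<Rightarrow> nat \<Rightarrow> (nat \<Rightarrow> nat) \<Rightarrow> 'a \<Rightarrow> 'a"

definition semi_simplicial :: "'a ssset \<Rightarrow> bool" where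
  "semi_simplicial X \<longleftrightarrow>
     (\<forall>m n. \<forall>\<theta> \<in> strict_maps m n. pull X m n \<theta> \<in> simplices X n \<rightarrow> simplices X m) \<and>
     (\<forall>n. \<forall>x \<in> simplices X n. pull X n n (\<lambda>k\<in>{..n}. k) x = x) \<and>
     (\<forall>l m n. \<forall>\<theta> \<in> strict_maps l m. \<forall>\<phi> \<in> strict_maps m n. \<forall>x \<in> simplices X n.
        pull X l n (compose {..l} \<phi> \<theta>) x = pull X l m \<theta> (pull X m n \<phi> x))"

text \<open>The strictly monotone map $[n] \to [n+1]$ whose image omits $i$.\<close>

definition coface :: "nat \<Rightarrow> nat \<Rightarrow> nat \<Rightarrow> nat" where
  "coface n i = (\<lambda>k\<in>{..n}. if k < i then k else Suc k)"

text \<open>The face map $d_i : X_{n+1} \to X_n$.\<close>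

definition face :: "'a ssset \<Rightarrow> nat \<Rightarrow> nat \<Rightarrow> 'a \<Rightarrow> 'a" where
  "face X n i = pull X n (Suc n) (coface n i)"

lemma coface_strict_maps: "coface n i \<in> strict_maps n (Suc n)"
  by (auto simp: coface_def strict_maps_def strict_mono_on_def)


section \<open>Geometric realisation\<close>

text \<open>
  The finest topology on the set \<open>Y\<close> making \<open>f\<close> continuous; \<open>f\<close> is meant to map
  \<^term>\<open>topspace X\<close> into \<open>Y\<close>, and if it does so surjectively this is the quotient topology.
\<close>

definition coinduced_topology :: "'b set \<Rightarrow> 'a topology \<Rightarrow> ('a \<Rightarrow> 'b) \<Rightarrow> 'b topology" where
  "coinduced_topology Y X f =
     topology (\<lambda>U. U \<subseteq> Y \<and> openin X {x \<in> topspace X. f x \<in> U})"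

lemma openin_coinduced_topology:
  "openin (coinduced_topology Y X f) U \<longleftrightarrow> U \<subseteq> Y \<and> openin X {x \<in> topspace X. f x \<in> U}"
proof -
  have "istopology (\<lambda>U. U \<subseteq> Y \<and> openin X {x \<in> topspace X. f x \<in> U})"
    unfolding istopology_def
  proof (rule conjI; safe)
    fix S T assume "openin X {x \<in> topspace X. f x \<in> S}" "openin X {x \<in> topspace X. f x \<in> T}"
    then have "openin X ({x \<in> topspace X. f x \<in> S} \<inter> {x \<in> topspace X. f x \<in> T})"
      by blast
    then show "openin X {x \<in> topspace X. f x \<in> S \<inter> T}"
      by (rule back_subst) auto
  next
    fix \<K> assume "\<forall>K\<in>\<K>. K \<subseteq> Y \<and> openin X {x \<in> topspace X. f x \<in> K}"
    then have "openin X (\<Union>K\<in>\<K>. {x \<in> topspace X. f x \<in> K})"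
      by blast
    then show "openin X {x \<in> topspace X. f x \<in> \<Union>\<K>}"
      by (rule back_subst) auto
  qed auto
  then show ?thesis
    by (simp add: coinduced_topology_def)
qed

lemma topspace_coinduced_topology:
  assumes "f \<in> topspace X \<rightarrow> Y"
  shows "topspace (coinduced_topology Y X f) = Y"
proof (rule subset_antisym)
  show "topspace (coinduced_topology Y X f) \<subseteq> Y"
    by (metis openin_coinduced_topology openin_topspace)
  have "{x \<in> topspace X. f x \<in> Y} = topspace X"
    using assms by auto
  then show "Y \<subseteq> topspace (coinduced_topology Y X f)"
    by (simp add: openin_coinduced_topology openin_subset)
qed

lemma quotient_map_coinduced_topology:
  assumes "f ` topspace X = Y"
  shows "quotient_map X (coinduced_topology Y X f) f"
proof -
  have "topspace (coinduced_topology Y X f) = Y"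
    using assms by (intro topspace_coinduced_topology) auto
  with assms show ?thesis
    by (auto simp: quotient_map_def openin_coinduced_topology)
qed

text \<open>The space $\coprod_n X_n \times \Delta^n$, with points \<open>(n, x, y)\<close>.\<close>

definition simplex_coproduct :: "'a ssset \<Rightarrow> (nat \<times> 'a \<times> (nat \<Rightarrow> real)) topology" where
  "simplex_coproduct X =
     sum_topology
       (\<lambda>n. prod_topology (discrete_topology (simplices X n))
                          (subtopology (powertop_real UNIV) (standard_simplex n)))
       UNIV"

text \<open>
  The relation $(d_i x, y) \sim (x, d^i y)$.  The coface inclusion
  $d^i : \Delta^n \to \Delta^{n+1}$ is \<^term>\<open>simplical_face i\<close>, which inserts a zero at
  position \<open>i\<close>.
\<close>

definition glue :: "'a ssset \<Rightarrow> ((nat \<times> 'a \<times> (nat \<Rightarrow> real)) \<times> (nat \<times> 'a \<times> (nat \<Rightarrow> real))) set" where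
  "glue X = {((n, face X n i x, y), (Suc n, x, simplical_face i y)) | n i x y.
               i \<le> Suc n \<and> x \<in> simplices X (Suc n) \<and> y \<in> standard_simplex n}"

definition glue_equiv :: "'a ssset \<Rightarrow> ((nat \<times> 'a \<times> (nat \<Rightarrow> real)) \<times> (nat \<times> 'a \<times> (nat \<Rightarrow> real))) set" where
  "glue_equiv X = (glue X \<union> (glue X)\<inverse>)\<^sup>*"

definition realisation :: "'a ssset \<Rightarrow> (nat \<times> 'a \<times> (nat \<Rightarrow> real)) set topology" where
  "realisation X =
     coinduced_topology (topspace (simplex_coproduct X) // glue_equiv X)
       (simplex_coproduct X) (\<lambda>p. glue_equiv X `` {p})"

lemma topspace_simplex_coproduct:
  "topspace (simplex_coproduct X) = (SIGMA n:UNIV. simplices X n \<times> standard_simplex n)"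
  by (auto simp: simplex_coproduct_def)

lemma glue_subset:
  assumes "semi_simplicial X"
  shows "glue X \<subseteq> topspace (simplex_coproduct X) \<times> topspace (simplex_coproduct X)"
proof -
  have "face X n i x \<in> simplices X n" if "x \<in> simplices X (Suc n)" for n i x
    using assms that coface_strict_maps unfolding semi_simplicial_def face_def by blast
  moreover have "simplical_face i y \<in> standard_simplex (Suc n)"
    if "i \<le> Suc n" "y \<in> standard_simplex n" for n i y
    using that by (intro simplical_face_in_standard_simplex) auto
  ultimately show ?thesis
    by (auto simp: glue_def topspace_simplex_coproduct)
qed

lemma quotient_map_realisation:
  "quotient_map (simplex_coproduct X) (realisation X) (\<lambda>p. glue_equiv X `` {p})"
  unfolding realisation_def
  by (intro quotient_map_coinduced_topology) (auto simp: quotient_def)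


section \<open>The complex of injective words\<close>

definition injective_words :: "'a set \<Rightarrow> 'a list ssset" where
  "injective_words C =
     \<lparr>simplices = (\<lambda>n. {xs. length xs = Suc n \<and> distinct xs \<and> set xs \<subseteq> C}),
      pull = (\<lambda>m n \<theta> xs. map (\<lambda>k. xs ! \<theta> k) [0..<Suc m])\<rparr>"

lemma semi_simplicial_injective_words: "semi_simplicial (injective_words C)"
proof -
  have 1: "map (\<lambda>k. xs ! \<theta> k) [0..<Suc m] \<in> simplices (injective_words C) m"
    if \<theta>: "\<theta> \<in> strict_maps m n" and xs: "xs \<in> simplices (injective_words C) n" for m n \<theta> xs
  proof -
    have le: "\<theta> k < length xs" if "k \<le> m" for k
      using \<theta> xs that by (auto simp: strict_maps_def injective_words_def less_Suc_eq_le)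
    have "inj_on \<theta> {..m}"
      using \<theta> strict_mono_on_imp_inj_on by (auto simp: strict_maps_def)
    then have "inj_on (\<lambda>k. xs ! \<theta> k) {..m}"
      using le xs by (auto simp: inj_on_def injective_words_def nth_eq_iff_index_eq)
    moreover have "{0..<Suc m} = {..m}"
      by auto
    ultimately have "distinct (map (\<lambda>k. xs ! \<theta> k) [0..<Suc m])"
      by (simp add: distinct_map del: upt_Suc)
    moreover have "xs ! \<theta> k \<in> C" if "k \<le> m" for k
      using le[OF that] xs by (auto simp: injective_words_def)
    ultimately show ?thesis
      by (auto simp: injective_words_def simp del: upt_Suc)
  qed
  have 2: "map (\<lambda>k. xs ! (\<lambda>k\<in>{..n}. k) k) [0..<Suc n] = xs"
    if "length xs = Suc n" for n and xs :: "'a list"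
    by (rule nth_equalityI) (use that in \<open>auto simp del: upt_Suc\<close>)
  have 3: "map (\<lambda>k. xs ! compose {..l} \<phi> \<theta> k) [0..<Suc l] =
        map (\<lambda>k. map (\<lambda>k. xs ! \<phi> k) [0..<Suc m] ! \<theta> k) [0..<Suc l]"
    if "\<theta> \<in> strict_maps l m" for l m \<theta> \<phi> and xs :: "'a list"
  proof (rule map_cong[OF refl])
    fix k assume "k \<in> set [0..<Suc l]"
    then have "k \<in> {..l}" by auto
    moreover from this have "\<theta> k < Suc m"
      using that by (auto simp: strict_maps_def less_Suc_eq_le)
    ultimately show "xs ! compose {..l} \<phi> \<theta> k = map (\<lambda>k. xs ! \<phi> k) [0..<Suc m] ! \<theta> k"
      by (simp add: compose_def del: upt_Suc)
  qed
  show ?thesis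
    unfolding semi_simplicial_def
    using 1 2 3 by (auto simp: injective_words_def simp del: upt_Suc)
qed

lemma face_injective_words:
  assumes "i \<le> Suc n" "xs \<in> simplices (injective_words C) (Suc n)"
  shows "face (injective_words C) n i xs = take i xs @ drop (Suc i) xs"
  using assms
  by (intro nth_equalityI)
     (auto simp: face_def coface_def injective_words_def nth_append simp del: upt_Suc)


section \<open>Wedges of spheres\<close>

text \<open>
  The wedge of the spaces \<open>X i\<close> for \<open>i \<in> I\<close>, with base points \<open>b i\<close>.  The common base
  point is \<^term>\<open>None\<close>, which is present also if \<open>I\<close> is empty; the wedge is then a point.
\<close>

definition wedge :: "'i set \<Rightarrow> ('i \<Rightarrow> 'b topology) \<Rightarrow> ('i \<Rightarrow> 'b) \<Rightarrow> ('i \<times> 'b) option topology" where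
  "wedge I X b =
     coinduced_topology
       (insert None (Some ` (SIGMA i:I. topspace (X i) - {b i})))
       (sum_topology X I)
       (\<lambda>(i, x). if x = b i then None else Some (i, x))"

text \<open>
  A wedge of \<open>d\<close>-spheres indexed by \<open>J\<close>.  The $(-1)$-sphere is the empty space.  As it has no
  base point, no wedge of several copies can be formed, and the only wedge of $(-1)$-spheres
  is the empty space itself, whatever \<open>J\<close> is.
\<close>

definition wedge_of_spheres :: "int \<Rightarrow> 'i set \<Rightarrow> ('i \<times> (nat \<Rightarrow> real)) option topology" where
  "wedge_of_spheres d J =
     (if d < 0 then trivial_topology
      else wedge J (\<lambda>_. nsphere (nat d)) (\<lambda>_ k. if k = 0 then 1 else 0))"

lemma topspace_wedge:
  "topspace (wedge I X b) = insert None (Some ` (SIGMA i:I. topspace (X i) - {b i}))"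
  unfolding wedge_def by (rule topspace_coinduced_topology) (auto simp: image_iff split: if_splits)

lemma quotient_map_wedge:
  assumes "I \<noteq> {}" "\<And>i. i \<in> I \<Longrightarrow> b i \<in> topspace (X i)"
  shows "quotient_map (sum_topology X I) (wedge I X b)
           (\<lambda>(i, x). if x = b i then None else Some (i, x))"
  unfolding wedge_def
proof (intro quotient_map_coinduced_topology equalityI)
  let ?q = "\<lambda>(i, x). if x = b i then None else Some (i, x)"
  obtain j where j: "j \<in> I" using assms(1) by blast
  have "None \<in> ?q ` topspace (sum_topology X I)"
    by (rule image_eqI[where x = "(j, b j)"]) (use j assms(2) in auto)
  moreover have "Some (i, x) \<in> ?q ` topspace (sum_topology X I)"
    if "i \<in> I" "x \<in> topspace (X i)" "x \<noteq> b i" for i x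
    by (rule image_eqI[where x = "(i, x)"]) (use that in auto)
  ultimately show "insert None (Some ` (SIGMA i:I. topspace (X i) - {b i}))
      \<subseteq> ?q ` topspace (sum_topology X I)"
    by auto
qed (auto simp: image_iff split: if_splits)

end

theory Submission
  imports Defs "HOL-Library.Sublist" "HOL-Analysis.Analysis"
begin

text \<open>
  Let there be \<open>n > 0\<close> letters; without letters both spaces are empty.  The complex of
  injective words is a contractible subcomplex \<open>Z\<close> together with some top-dimensional simplices, those of certain words that use
  every letter.  Since their boundaries lie in \<open>Z\<close>, contracting \<open>Z\<close> to a point turns each of
  them into a sphere of dimension \<open>n - 1\<close> and does not change the homotopy type.

  The subcomplex comes from a matching of words (\<open>matched\<close>): fix a letter \<open>c\<close>.  A word \<open>v\<close>
  without \<open>c\<close> is matched with \<open>c # v\<close>; a word \<open>u @ c # v\<close> with \<open>u\<close> nonempty is treated by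
  matching \<open>v\<close> recursively over the letters that occur neither in \<open>u\<close> nor as \<open>c\<close>.  Words that
  remain unmatched use every letter (\<open>unmatched_full\<close>).  A rank on matched pairs shows that
  the pairs can be removed one after the other, each by an elementary collapse
  (\<open>matched_subword_rank\<close>, \<open>elementary_collapse\<close>), until a single vertex is left; the empty
  word, matched with a one-letter word, accounts for the vertex.  So the matched words form
  a contractible complex (\<open>contractible_matched_words\<close>).

  The topology is carried out in a concrete model.  A point of the realisation is a word \<open>w\<close>
  with weights \<open>a\<close> on its letters; it is sent to the function that assigns to each word \<open>v\<close>
  the product of the weights of its letters if \<open>v\<close> is a subword of \<open>w\<close>, and \<open>0\<close> otherwise
  (\<open>word_point\<close>).  This respects the face identifications, because a letter of weight zero
  kills every product that contains it.  It separates points: the word is the longest one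
  with a nonzero value, and the weights are the values on one-letter words.  As these weights
  depend continuously on the image and there are only finitely many cells, the realisation is
  homeomorphic to a subspace of a product of lines
  (\<open>realisation_homeomorphic_word_space\<close>), where a map can be defined on finitely many closed
  cells, in global coordinates, and only has to be compared on overlaps.

  The passage to the wedge (\<open>attached_simplices.homotopy_equivalent_wedge_of_spheres\<close>)
  extends the contraction of \<open>Z\<close> to a homotopy of the whole space, using collars in the
  attached simplices, and compares the space with its quotient by \<open>Z\<close>, which is the wedge by
  an explicit map from a simplex onto a sphere that collapses exactly the boundary
  (\<open>simplex_to_sphere\<close>).
\<close>

section \<open>A matching on injective words\<close>

text \<open>An order embedding of the nonnegative reals into \<open>[0, 1)\<close>, so that \<open>k + squash r\<close> compares
  pairs \<open>(k, r)\<close>, with \<open>k\<close> a natural number, lexicographically.\<close>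

definition squash :: "real \<Rightarrow> real" where "squash x = x / (1 + x)"

lemma squash_bounds: "0 \<le> x \<Longrightarrow> 0 \<le> squash x \<and> squash x < 1"
  by (simp add: squash_def)

lemma squash_strict_mono: "0 \<le> x \<Longrightarrow> x < y \<Longrightarrow> squash x < squash y"
  by (simp add: squash_def divide_simps algebra_simps)

definition pivot :: "'a set \<Rightarrow> 'a" where "pivot A = (SOME c. c \<in> A)"

lemma pivot_in: "A \<noteq> {} \<Longrightarrow> pivot A \<in> A"
  unfolding pivot_def by (simp add: some_in_eq)

text \<open>In \<open>matched A r v w\<close>, the word \<open>w\<close> arises from \<open>v\<close> by inserting one letter, and \<open>r\<close> is the
  rank of the pair: it compares first the number of letters before the pivot and then,
  recursively, the rank of the pair behind it.  Pairs with the pivot in front are compared by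
  length.\<close>

inductive matched :: "'a set \<Rightarrow> real \<Rightarrow> 'a list \<Rightarrow> 'a list \<Rightarrow> bool" where
  front: "\<lbrakk>A \<noteq> {}; c = pivot A; distinct v; set v \<subseteq> A - {c}\<rbrakk>
    \<Longrightarrow> matched A (squash (length v)) v (c # v)"
| behind: "\<lbrakk>A \<noteq> {}; c = pivot A; u \<noteq> []; distinct u; set u \<subseteq> A - {c};
     matched (A - {c} - set u) r v v'\<rbrakk>
    \<Longrightarrow> matched A (length u + squash r) (u @ c # v) (u @ c # v')"

lemma matched_rank_nonneg: "matched A r v w \<Longrightarrow> 0 \<le> r"
  by (induction rule: matched.induct) (auto simp: squash_bounds add_nonneg_nonneg)

lemma matched_word: "matched A r v w \<Longrightarrow> distinct w \<and> set w \<subseteq> A"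
proof (induction rule: matched.induct)
  case (front A c v)
  then show ?case using pivot_in[of A] by auto
next
  case (behind A c u r v v')
  then show ?case using pivot_in[of A] by auto
qed

lemma matched_insert: "matched A r v w \<Longrightarrow> \<exists>l1 x l2. v = l1 @ l2 \<and> w = l1 @ x # l2"
proof (induction rule: matched.induct)
  case (front A c v)
  then show ?case by (metis append_Nil)
next
  case (behind A c u r v v')
  then obtain l1 x l2 where "v = l1 @ l2" "v' = l1 @ x # l2" by blast
  then show ?case by (metis append.assoc append_Cons)
qed

lemma matched_subseq: "matched A r v w \<Longrightarrow> subseq v w"
  using matched_insert by (metis list_emb_append_mono subseq_order.order_refl list_emb_Cons)

text \<open>Peeling off the part of a word up to the pivot removes the same letters from the word and
  from the alphabet, so the property of missing a letter persists in the recursion.  It fails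
  for the empty word over the empty alphabet, the only place where the recursion gets stuck.\<close>

lemma matched_total:
  assumes "finite A" "distinct w" "set w \<subset> A"
  shows "\<exists>r v v'. matched A r v v' \<and> (w = v \<or> w = v')"
  using assms
proof (induction "card A" arbitrary: A w rule: less_induct)
  case less
  have ne: "A \<noteq> {}" using less.prems by auto
  define c where "c = pivot A"
  have c: "c \<in> A" unfolding c_def by (rule pivot_in[OF ne])
  show ?case
  proof (cases "c \<in> set w")
    case False
    then have "matched A (squash (length w)) w (c # w)"
      using less.prems c_def ne by (intro matched.front) auto
    then show ?thesis by blast
  next
    case True
    then obtain u v where w: "w = u @ c # v" by (meson split_list)
    show ?thesis
    proof (cases "u = []")
      case True
      then have "matched A (squash (length v)) v w"
        using less.prems c_def ne w by (auto intro!: matched.front)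
      then show ?thesis by blast
    next
      case False
      let ?B = "A - {c} - set u"
      have "card ?B < card A"
        using c less.prems(1) by (intro psubset_card_mono) auto
      moreover have "set v \<subset> ?B" using less.prems w by auto
      ultimately obtain r x y where m: "matched ?B r x y" "v = x \<or> v = y"
        using less.hyps[of ?B v] less.prems w by auto
      have "matched A (length u + squash r) (u @ c # x) (u @ c # y)"
        using less.prems w False ne c_def m(1) by (intro matched.behind) auto
      then show ?thesis using w m(2) by blast
    qed
  qed
qed

lemma append_Cons_unique:
  assumes "u @ c # v = u' @ c # v'" "c \<notin> set u" "c \<notin> set u'"
  shows "u = u' \<and> v = v'"
  using assms
proof (induction u arbitrary: u')
  case Nil
  then show ?case by (cases u') auto
next
  case (Cons a u)
  then show ?case by (cases u') auto
qed

text \<open>The pivot occurs at most once in a word, so the rule that applies and the data \<open>u\<close>, \<open>v\<close> in it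
  can be read off from either member of the pair.\<close>

lemma matched_unique:
  assumes "matched A r v v'" "matched A q w w'" "v = w \<or> v = w' \<or> v' = w \<or> v' = w'"
  shows "r = q \<and> v = w \<and> v' = w'"
  using assms
proof (induction arbitrary: q w w' rule: matched.induct)
  case (front A c v)
  have cv: "c \<notin> set v" using front.hyps by auto
  from front(5) show ?case
  proof cases
    case (front c')
    then have "c \<notin> set w" using \<open>c = pivot A\<close> by auto
    then show ?thesis using front \<open>c = pivot A\<close> front.prems(2) cv by auto
  next
    case (behind c' u r x y)
    have "c \<in> set w" "c \<in> set w'" using behind \<open>c = pivot A\<close> by auto
    moreover have "hd w \<noteq> c" "hd w' \<noteq> c"
      using behind \<open>c = pivot A\<close> by (cases u; auto)+
    ultimately have False using front.prems(2) cv by auto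
    then show ?thesis ..
  qed
next
  case (behind A c u r x y)
  have cu: "c \<notin> set u" using behind.hyps by auto
  from behind(8) show ?case
  proof cases
    case (front c')
    then have "c \<notin> set w" "hd w' = c" using \<open>c = pivot A\<close> by auto
    moreover have "hd (u @ t) \<noteq> c" for t using cu \<open>u \<noteq> []\<close> by (cases u) auto
    ultimately have False
      using behind.prems(2) by (metis in_set_conv_decomp)
    then show ?thesis ..
  next
    case (behind c' u' r' x' y')
    have cu': "c \<notin> set u'" using behind \<open>c = pivot A\<close> by auto
    have "c' = c" using behind \<open>c = pivot A\<close> by simp
    have eq: "u = u' \<and> (x = x' \<or> x = y' \<or> y = x' \<or> y = y')"
      using behind.prems(2) append_Cons_unique[OF _ cu cu']
      unfolding \<open>w = _\<close> \<open>w' = _\<close> \<open>c' = c\<close> by blast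
    then have "r = r' \<and> x = x' \<and> y = y'"
      using behind.IH[of r' x' y'] behind(9) unfolding \<open>c' = c\<close> by blast
    then show ?thesis using behind eq \<open>c' = c\<close> by simp
  qed
qed

lemma subseq_imp_subset: "subseq v w \<Longrightarrow> set v \<subseteq> set w"
  by (auto elim: list_emb_set)

lemma subseq_imp_distinct: "subseq v w \<Longrightarrow> distinct w \<Longrightarrow> distinct v"
  by (auto simp: subseq_conv_nths)

lemma subseq_length_less: "subseq v w \<Longrightarrow> v \<noteq> w \<Longrightarrow> length v < length w"
  by (metis list_emb_length subseq_same_length le_neq_implies_less)

text \<open>This is acyclicity of the matching.  Passing to a subword either loses the pivot, which
  leaves a pair of rank below \<open>1\<close>; or it loses a letter before the pivot, which lowers the
  leading term of the rank (and what follows the pivot then misses that letter, hence is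
  matched); or it only changes the part behind the pivot, where induction applies.\<close>

lemma matched_subword_rank:
  assumes "matched A r v v'" "finite A" "subseq w v'" "w \<noteq> v" "w \<noteq> v'"
  shows "\<exists>q x y. matched A q x y \<and> (w = x \<or> w = y) \<and> q < r"
  using assms
proof (induction arbitrary: w rule: matched.induct)
  case (front A c v)
  have m: "matched A (squash (length x)) x (c # x) \<and> squash (length x) < squash (length v)"
    if "subseq x v" "x \<noteq> v" for x
    using that front subseq_imp_subset[OF that(1)] subseq_imp_distinct[OF that(1)]
      subseq_length_less[OF that]
    by (auto intro!: matched.front squash_strict_mono)
  consider "subseq w v" | w1 where "w = c # w1" "subseq w1 v"
    using front.prems(2) by (cases rule: list_emb.cases) auto
  then show ?case
  proof cases
    case 1
    then show ?thesis using m front.prems(3) by blast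
  next
    case 2
    then show ?thesis using m[of w1] front.prems(4) by blast
  qed
next
  case (behind A c u r x y)
  let ?B = "A - {c} - set u"
  have y: "distinct y" "set y \<subseteq> ?B" using matched_word[OF behind(6)] by auto
  have cA: "c \<in> A" using pivot_in[OF behind(1)] behind(2) by simp
  have dw: "distinct w" "set w \<subseteq> A"
    using subseq_imp_distinct[OF behind.prems(2)] subseq_imp_subset[OF behind.prems(2)] y behind(4,5) cA
    by auto
  have r: "0 \<le> squash r" using matched_rank_nonneg[OF behind(6)] squash_bounds by blast
  have u1: "1 \<le> real (length u)" using \<open>u \<noteq> []\<close> by (cases u) auto
  show ?case
  proof (cases "c \<in> set w")
    case False
    have "matched A (squash (length w)) w (c # w)"
      using dw False behind(1,2) by (intro matched.front) auto
    moreover have "squash (length w) < length u + squash r"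
      using squash_bounds[of "length w"] r u1 by linarith
    ultimately show ?thesis by blast
  next
    case True
    then obtain u' v' where w: "w = u' @ c # v'" by (meson split_list)
    have c: "c \<notin> set u" "c \<notin> set y" "c \<notin> set u'" "c \<notin> set v'" using behind(5) y dw w by auto
    have sub: "subseq u' u \<and> subseq v' y"
    proof -
      obtain a b where ab: "w = a @ b" "subseq a u" "subseq b (c # y)"
        using behind.prems(2) subseq_appendE by blast
      then have "c \<notin> set a" using c(1) subseq_imp_subset by blast
      then have "c \<in> set b" using True ab by auto
      then obtain b' where b': "b = c # b'" "subseq b' y"
        using ab(3) c(2) subseq_imp_subset[of b y] by (cases b) (auto split: if_splits)
      then show ?thesis using append_Cons_unique[of a c b' u' v'] ab w c(3) \<open>c \<notin> set a\<close> by auto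
    qed
    show ?thesis
    proof (cases "u' = []")
      case True
      have "matched A (squash (length v')) v' w"
        unfolding w True append_Nil using dw w True behind(1,2) by (intro matched.front) auto
      moreover have "squash (length v') < length u + squash r"
        using squash_bounds[of "length v'"] r u1 by linarith
      ultimately show ?thesis by blast
    next
      case ne: False
      show ?thesis
      proof (cases "u' = u")
        case True
        then have "v' \<noteq> x" "v' \<noteq> y" using behind.prems w by auto
        then obtain q a b where q: "matched ?B q a b" "v' = a \<or> v' = b" "q < r"
          using behind.IH[of v'] sub behind.prems(1) by auto
        have "matched A (length u + squash q) (u @ c # a) (u @ c # b)"
          using behind(1-5) q by (intro matched.behind) auto
        moreover have "squash q < squash r"
          using squash_strict_mono matched_rank_nonneg[OF q(1)] q(3) by blast
        ultimately show ?thesis using w True q(2) by (metis add_strict_left_mono)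
      next
        case False
        let ?B' = "A - {c} - set u'"
        have len: "length u' < length u" using subseq_length_less sub False by blast
        have "set u \<noteq> set u'"
          using len behind(4) dw w by (metis distinct_card distinct_append less_irrefl)
        then obtain d where "d \<in> set u" "d \<notin> set u'" using sub subseq_imp_subset[of u' u] by blast
        then have "d \<in> ?B'" "d \<notin> set v'"
          using behind(5) sub subseq_imp_subset[of v' y] y by auto
        moreover have "set v' \<subseteq> ?B'" using dw w by auto
        ultimately have "set v' \<subset> ?B'" by blast
        then obtain q a b where q: "matched ?B' q a b" "v' = a \<or> v' = b"
          using matched_total[of ?B' v'] behind.prems(1) dw w by auto
        have "matched A (length u' + squash q) (u' @ c # a) (u' @ c # b)"
          using behind(1,2) dw w ne q by (intro matched.behind) auto
        moreover have "length u' + squash q < length u + squash r"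
          using squash_bounds[OF matched_rank_nonneg[OF q(1)]] r len by linarith
        ultimately show ?thesis using w q(2) by blast
      qed
    qed
  qed
qed

section \<open>Word spaces\<close>

lemma continuous_on_coordinate: "continuous_on S (\<lambda>x. x i)"
  for S :: "('i \<Rightarrow> 'b::topological_space) set"
  by (rule continuous_on_subset[OF continuous_on_product_coordinates]) auto

text \<open>The coordinates of the point of the simplex \<open>w\<close> with barycentric coordinates \<open>a\<close>.  Indexing
  the barycentric coordinates by letters, and not by positions, makes them independent of the
  simplex that contains the point.\<close>

definition word_point :: "'a list \<Rightarrow> ('a \<Rightarrow> real) \<Rightarrow> 'a list \<Rightarrow> real" where
  "word_point w a = (\<lambda>v. if subseq v w then \<Prod>c\<in>set v. a c else 0)"

definition weights :: "'a list \<Rightarrow> ('a \<Rightarrow> real) set" where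
  "weights w = {a. (\<forall>c. 0 \<le> a c) \<and> (\<forall>c. c \<notin> set w \<longrightarrow> a c = 0) \<and> sum a (set w) = 1}"

definition cell :: "'a list \<Rightarrow> ('a list \<Rightarrow> real) set" where
  "cell w = word_point w ` weights w"

definition word_space :: "'a list set \<Rightarrow> ('a list \<Rightarrow> real) set" where
  "word_space K = (\<Union>w\<in>K. cell w)"

definition letter_weights :: "('a list \<Rightarrow> real) \<Rightarrow> 'a \<Rightarrow> real" where
  "letter_weights p = (\<lambda>c. p [c])"

lemma letter_weights_word_point [simp]: "a \<in> weights w \<Longrightarrow> letter_weights (word_point w a) = a"
  by (auto simp: letter_weights_def word_point_def weights_def subseq_singleton_left)

lemma continuous_on_word_point: "continuous_on S (word_point w)"
  unfolding word_point_def
proof (rule continuous_on_coordinatewise_then_product)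
  show "continuous_on S (\<lambda>a. if subseq v w then prod a (set v) else 0)" for v
    by (cases "subseq v w") (auto intro!: continuous_intros continuous_on_coordinate)
qed

lemma continuous_on_letter_weights: "continuous_on S letter_weights"
  unfolding letter_weights_def
  by (intro continuous_on_coordinatewise_then_product continuous_on_coordinate)

lemma closed_weights: "closed (weights w)"
  unfolding weights_def
  by (intro closed_Collect_conj closed_Collect_all closed_Collect_imp closed_Collect_le closed_Collect_eq
      continuous_intros continuous_on_coordinate continuous_on_sum) auto

text \<open>As the weights of a point can be read off from its values on one-letter words, membership in a
  cell is a closed condition.\<close>

lemma cell_eq: "cell w = {p. letter_weights p \<in> weights w \<and> p = word_point w (letter_weights p)}"
  unfolding cell_def by auto

lemma closed_cell: "closed (cell w)"
proof -
  have "{p. p = word_point w (letter_weights p)} = {p. \<forall>v. p v = word_point w (letter_weights p) v}"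
    by auto
  moreover have "closed {p. \<forall>v. p v = word_point w (letter_weights p) v}"
    by (intro closed_Collect_all closed_Collect_eq continuous_on_coordinate
        continuous_on_product_then_coordinatewise[OF
          continuous_on_compose2[OF continuous_on_word_point[of UNIV] continuous_on_letter_weights]]) auto
  moreover have "closed (letter_weights -` weights w)"
    by (intro closed_vimage closed_weights continuous_on_letter_weights)
  moreover have "cell w = letter_weights -` weights w \<inter> {p. p = word_point w (letter_weights p)}"
    by (auto simp: cell_eq)
  ultimately show ?thesis by (simp only: closed_Int)
qed

lemma closed_word_space: "finite K \<Longrightarrow> closed (word_space K)"
  unfolding word_space_def by (auto intro!: closed_UN closed_cell)

lemma word_space_mono: "K \<subseteq> L \<Longrightarrow> word_space K \<subseteq> word_space L"
  by (auto simp: word_space_def)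

lemma subseq_eq_filter:
  assumes "distinct w" "subseq v w"
  shows "v = filter (\<lambda>c. c \<in> set v) w"
  using assms(2,1)
proof (induction rule: list_emb.induct)
  case (list_emb_Nil w)
  then show ?case by simp
next
  case (list_emb_Cons v w c)
  then have "c \<notin> set v" using subseq_imp_subset by fastforce
  then show ?case using list_emb_Cons by simp
next
  case (list_emb_Cons2 c d v w)
  then have "c \<notin> set w" by auto
  then have "filter (\<lambda>x. x \<in> set (c # v)) w = filter (\<lambda>x. x \<in> set v) w"
    by (intro filter_cong) auto
  then show ?case using list_emb_Cons2 by simp
qed

lemma subseq_of_subset:
  assumes "distinct w" "subseq u w" "subseq v w" "set u \<subseteq> set v"
  shows "subseq u v"
proof -
  have "u = filter (\<lambda>c. c \<in> set u) (filter (\<lambda>c. c \<in> set v) w)"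
    using subseq_eq_filter[OF assms(1,2)] assms(4) by (metis (no_types, lifting) filter_cong filter_filter subsetD)
  then show ?thesis using subseq_eq_filter[OF assms(1,3)] by (metis subseq_filter_left)
qed

text \<open>The model respects face identifications: letters of weight zero can be dropped from the word.\<close>

lemma word_point_subword:
  assumes "distinct w" "subseq v w" "\<And>c. c \<notin> set v \<Longrightarrow> a c = 0"
  shows "word_point w a = word_point v a"
proof
  fix u
  show "word_point w a u = word_point v a u"
  proof (cases "subseq u w")
    case True
    show ?thesis
    proof (cases "set u \<subseteq> set v")
      case True
      then show ?thesis using subseq_of_subset[OF assms(1) \<open>subseq u w\<close> assms(2)] \<open>subseq u w\<close>
        by (simp add: word_point_def)
    next
      case False
      then have "(\<Prod>c\<in>set u. a c) = 0" using assms(3) by auto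
      moreover have "\<not> subseq u v" using False subseq_imp_subset by blast
      ultimately show ?thesis by (simp add: word_point_def)
    qed
  next
    case False
    then have "\<not> subseq u v" using assms(2) subseq_order.trans by blast
    then show ?thesis using False by (simp add: word_point_def)
  qed
qed

lemma weights_subword:
  assumes "a \<in> weights w" "set v \<subseteq> set w" "\<And>c. c \<notin> set v \<Longrightarrow> a c = 0"
  shows "a \<in> weights v"
proof -
  have "sum a (set v) = sum a (set w)"
    using assms by (intro sum.mono_neutral_left) auto
  then show ?thesis using assms by (auto simp: weights_def)
qed

lemma weights_superword:
  assumes "a \<in> weights v" "set v \<subseteq> set w"
  shows "a \<in> weights w"
proof -
  have "sum a (set v) = sum a (set w)"
    using assms by (intro sum.mono_neutral_left) (auto simp: weights_def)
  then show ?thesis using assms by (auto simp: weights_def)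
qed

lemma cell_subword:
  assumes "distinct w" "subseq v w"
  shows "cell v \<subseteq> cell w"
proof
  fix p assume "p \<in> cell v"
  then obtain a where a: "a \<in> weights v" "p = word_point v a" by (auto simp: cell_def)
  then have "p = word_point w a"
    using word_point_subword[OF assms, of a] by (auto simp: weights_def)
  then show "p \<in> cell w"
    using weights_superword[OF a(1) subseq_imp_subset[OF assms(2)]] by (auto simp: cell_def)
qed

lemma word_point_self_pos:
  assumes "a \<in> weights w" "subseq v w" "\<And>c. c \<in> set v \<Longrightarrow> a c \<noteq> 0"
  shows "word_point w a v \<noteq> 0"
  using assms by (simp add: word_point_def)

text \<open>A point is nonzero at the word of all its letters of positive weight, so any word whose cell
  contains the point has that word as a subword.\<close>

lemma word_space_support:
  assumes "p \<in> word_space K" "p v \<noteq> 0"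
  shows "\<exists>w\<in>K. subseq v w"
  using assms by (auto simp: word_space_def cell_def word_point_def split: if_splits)

section \<open>Collapsing the matched words\<close>

text \<open>Minima of barycentric coordinates measure the distance from the boundary of a simplex, both in
  collapses and in collars.\<close>

lemma continuous_on_Min_image:
  fixes f :: "'i \<Rightarrow> 'b::topological_space \<Rightarrow> real"
  assumes "finite I" "I \<noteq> {}" "\<And>i. i \<in> I \<Longrightarrow> continuous_on S (f i)"
  shows "continuous_on S (\<lambda>x. Min ((\<lambda>i. f i x) ` I))"
  using assms
proof (induction I rule: finite_ne_induct)
  case (singleton i)
  then show ?case by simp
next
  case (insert i I)
  then show ?case by (simp add: continuous_on_min)
qed

text \<open>The empty word belongs to every nonempty word complex; its cell is empty.\<close>

definition word_complex :: "'a list set \<Rightarrow> bool" where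
  "word_complex K \<longleftrightarrow> finite K \<and> (\<forall>w\<in>K. distinct w) \<and> (\<forall>w\<in>K. \<forall>v. subseq v w \<longrightarrow> v \<in> K)"

text \<open>If \<open>\<sigma>\<close> is a free face of \<open>\<tau>\<close>, opposite to the vertex \<open>x\<close>, then \<open>\<tau>\<close> is pushed away from \<open>\<sigma>\<close>
  along lines towards \<open>x\<close>: the smallest weight on \<open>\<sigma>\<close> is subtracted from every weight on \<open>\<sigma>\<close>
  and given to \<open>x\<close>.  A point of \<open>\<tau>\<close> is fixed exactly if some weight on \<open>\<sigma>\<close> vanishes, that is, if
  it lies on one of the faces that remain.\<close>

lemma elementary_collapse:
  assumes K: "word_complex K" and \<tau>: "\<tau> \<in> K" "\<tau> = l1 @ x # l2" and \<sigma>: "\<sigma> = l1 @ l2" "\<sigma> \<noteq> []"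
    and free: "\<And>w. w \<in> K \<Longrightarrow> subseq \<sigma> w \<Longrightarrow> w = \<sigma> \<or> w = \<tau>"
  shows "top_of_set (word_space K) homotopy_equivalent_space top_of_set (word_space (K - {\<sigma>, \<tau>}))"
proof -
  let ?L = "K - {\<sigma>, \<tau>}" and ?I = "{0..1::real}"
  let ?s = "\<lambda>a::'a \<Rightarrow> real. Min (a ` set \<sigma>)"
  define push where "push t a = (\<lambda>c. if c = x then a c + t * ?s a * card (set \<sigma>)
      else if c \<in> set \<sigma> then a c - t * ?s a else 0)" for t :: real and a :: "'a \<Rightarrow> real"
  have fin: "finite K" and dist: "\<And>w. w \<in> K \<Longrightarrow> distinct w" and sub: "\<And>v w. w \<in> K \<Longrightarrow> subseq v w \<Longrightarrow> v \<in> K"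
    using K by (auto simp: word_complex_def)
  have x: "x \<notin> set \<sigma>" and set\<tau>: "set \<tau> = insert x (set \<sigma>)" and sub\<sigma>: "subseq \<sigma> \<tau>"
    using dist[OF \<tau>(1)] \<tau> \<sigma> by (auto intro: list_emb_append_mono)
  have d\<tau>: "distinct \<tau>" using dist \<tau> by blast
  have ne: "set \<sigma> \<noteq> {}" using \<sigma> by simp
  have s_le: "?s a \<le> a c" if "c \<in> set \<sigma>" for a c using that by simp
  have s_nonneg: "0 \<le> ?s a" if "a \<in> weights \<tau>" for a
    using that ne by (auto simp: weights_def)
  have push_weights: "push t a \<in> weights \<tau>" if "t \<in> ?I" "a \<in> weights \<tau>" for t a
  proof -
    have "0 \<le> push t a c" for c
    proof -
      have "t * ?s a \<le> ?s a" using that s_nonneg[OF that(2)] by (simp add: mult_left_le_one_le)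
      moreover have "0 \<le> t * ?s a" using that s_nonneg[OF that(2)] by simp
      moreover have "t * ?s a \<le> a c" if "c \<in> set \<sigma>"
        using calculation(1) s_le[OF that, of a] by (rule order_trans)
      ultimately show ?thesis using that(2) by (auto simp: push_def weights_def)
    qed
    moreover have "sum (push t a) (set \<tau>) = 1"
    proof -
      have "sum (push t a) (set \<sigma>) = (\<Sum>c\<in>set \<sigma>. a c - t * ?s a)"
        using x by (intro sum.cong) (auto simp: push_def)
      then have "sum (push t a) (set \<tau>) = a x + sum a (set \<sigma>)"
        using x by (simp add: set\<tau> sum_subtractf push_def)
      also have "\<dots> = 1" using that(2) x by (simp add: weights_def set\<tau>)
      finally show ?thesis .
    qed
    ultimately show ?thesis using set\<tau> by (auto simp: weights_def push_def)
  qed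
  have push_0: "push 0 a = a" if "a \<in> weights \<tau>" for a
    using that by (auto simp: push_def weights_def set\<tau>)
  have push_fix: "push t a = a" if "a \<in> weights \<tau>" "?s a = 0" for t a
    using that by (auto simp: push_def weights_def set\<tau>)
  have cont_c: "continuous_on S (\<lambda>p. snd p c)" for S :: "(real \<times> ('a \<Rightarrow> real)) set" and c
    by (rule continuous_on_compose2[OF continuous_on_coordinate[of UNIV c] continuous_on_snd[OF continuous_on_id]]) auto
  have cont_s: "continuous_on S (\<lambda>p. ?s (snd p))" for S :: "(real \<times> ('a \<Rightarrow> real)) set"
    by (rule continuous_on_Min_image) (use ne cont_c in auto)
  have cont_push: "continuous_on S (\<lambda>p. push (fst p) (snd p))" for S
    unfolding push_def
  proof (rule continuous_on_coordinatewise_then_product)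
    fix c
    consider "c = x" | "c \<noteq> x" "c \<in> set \<sigma>" | "c \<noteq> x" "c \<notin> set \<sigma>" by blast
    then show "continuous_on S (\<lambda>p. if c = x then snd p c + fst p * ?s (snd p) * card (set \<sigma>)
        else if c \<in> set \<sigma> then snd p c - fst p * ?s (snd p) else 0)"
      by cases (auto intro!: continuous_on_add continuous_on_diff continuous_on_mult continuous_on_fst
          continuous_on_id continuous_on_const cont_c cont_s)
  qed
  \<comment> \<open>where a letter \<open>k\<close> of \<open>\<sigma>\<close> has weight zero, \<open>k\<close> can be dropped from \<open>\<tau>\<close>\<close>
  have in_L: "word_point \<tau> a \<in> word_space ?L" if a: "a \<in> weights \<tau>" "?s a = 0" for a
  proof -
    have "?s a \<in> a ` set \<sigma>" using ne by (intro Min_in) auto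
    then obtain k where k: "k \<in> set \<sigma>" "a k = 0" using a(2) by force
    let ?v = "filter (\<lambda>c. c \<noteq> k) \<tau>"
    have v: "subseq ?v \<tau>" by simp
    have "word_point \<tau> a = word_point ?v a" "a \<in> weights ?v"
      using k a word_point_subword[OF d\<tau> v, of a] weights_subword[OF a(1), of ?v]
      by (auto simp: weights_def)
    moreover have "?v \<in> ?L"
    proof -
      have kx: "k \<notin> set ?v" "x \<in> set ?v" using k x set\<tau> by auto
      have "?v \<noteq> \<sigma>" using kx(2) x by metis
      moreover have "?v \<noteq> \<tau>" using kx(1) k(1) set\<tau> by (metis insertI2)
      ultimately show ?thesis using sub[OF \<tau>(1) v] by blast
    qed
    ultimately show ?thesis unfolding word_space_def cell_def by blast
  qed
  \<comment> \<open>a point with positive weights on \<open>\<sigma>\<close> forces a word of the smaller complex to contain \<open>\<sigma>\<close>\<close>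
  have s_L: "?s a = 0" if a: "a \<in> weights \<tau>" "word_point \<tau> a \<in> word_space ?L" for a
  proof (rule ccontr)
    assume "?s a \<noteq> 0"
    then have "0 < ?s a" using s_nonneg[OF a(1)] by simp
    then have "a c \<noteq> 0" if "c \<in> set \<sigma>" for c using s_le[OF that, of a] by auto
    then have "word_point \<tau> a \<sigma> \<noteq> 0" using word_point_self_pos[OF a(1) sub\<sigma>] by blast
    then obtain w where "w \<in> ?L" "subseq \<sigma> w" using word_space_support[OF a(2)] by blast
    then show False using free by blast
  qed
  have union: "word_space K = word_space ?L \<union> cell \<tau>"
    using cell_subword[OF d\<tau> sub\<sigma>] \<tau>(1) by (auto simp: word_space_def)
  define H where "H p = (if snd p \<in> word_space ?L then snd p
      else word_point \<tau> (push (fst p) (letter_weights (snd p))))" for p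
  have agree: "word_point \<tau> (push t (letter_weights p)) = p" if "p \<in> cell \<tau>" "p \<in> word_space ?L" for t p
    using that s_L push_fix by (auto simp: cell_def)
  have contH: "continuous_on (?I \<times> word_space ?L \<union> ?I \<times> cell \<tau>) H"
    unfolding H_def
  proof (rule continuous_on_cases_local)
    show "closedin (top_of_set (?I \<times> word_space ?L \<union> ?I \<times> cell \<tau>)) (?I \<times> word_space ?L)"
      "closedin (top_of_set (?I \<times> word_space ?L \<union> ?I \<times> cell \<tau>)) (?I \<times> cell \<tau>)"
      using fin by (auto intro!: closed_subset closed_Times closed_word_space closed_cell)
    show "continuous_on (?I \<times> cell \<tau>) (\<lambda>p. word_point \<tau> (push (fst p) (letter_weights (snd p))))"
      by (intro continuous_on_compose2[OF continuous_on_word_point[of UNIV]]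
          continuous_on_compose2[OF cont_push[of UNIV], of _ "\<lambda>p. (fst p, letter_weights (snd p))", simplified]
          continuous_intros continuous_on_compose2[OF continuous_on_letter_weights[of UNIV]]) auto
  qed (use agree in \<open>auto intro: continuous_intros\<close>)
  have H_in: "H (t, p) \<in> word_space K" if "t \<in> ?I" "p \<in> word_space K" for t p
    using that push_weights[OF that(1)] unfolding union by (auto simp: H_def cell_def)
  have H1: "H (1, p) \<in> word_space ?L" if p: "p \<in> word_space K" for p
  proof (cases "p \<in> word_space ?L")
    case False
    then obtain a where a: "a \<in> weights \<tau>" "p = word_point \<tau> a" using p union by (auto simp: cell_def)
    have "?s a \<in> a ` set \<sigma>" using ne by (intro Min_in) auto
    then obtain k where k: "?s a = a k" "k \<in> set \<sigma>" by (rule imageE)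
    have "k \<noteq> x" using k(2) x by blast
    then have "push 1 a k = 0" using k by (simp add: push_def)
    then have "?s (push 1 a) = 0"
      using k push_weights[of 1 a] a(1) by (intro Min_eqI) (auto simp: weights_def)
    then show ?thesis using in_L push_weights[of 1 a] a False by (simp add: H_def)
  qed (simp add: H_def)
  have "word_space ?L \<subseteq> word_space K" using union by blast
  then show ?thesis
  proof (intro deformation_retract_imp_homotopy_equivalent_space[where r = "\<lambda>p. H (1, p)"])
    have eq: "?I \<times> word_space ?L \<union> ?I \<times> cell \<tau> = ?I \<times> word_space K" using union by auto
    have "H (0, p) = p" if "p \<in> word_space K" for p
      using that push_0 union by (auto simp: H_def cell_def)
    then have "homotopic_with (\<lambda>x. True) (top_of_set (word_space K)) (top_of_set (word_space K)) id (\<lambda>p. H (1, p))"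
      using contH H_in unfolding eq by (subst homotopic_with) (auto intro!: exI[of _ H])
    then show "homotopic_with (\<lambda>x. True) (top_of_set (word_space K)) (top_of_set (word_space K)) (\<lambda>p. H (1, p)) id"
      by (rule homotopic_with_symD)
    have "continuous_on (word_space K) (\<lambda>p. H (1, p))"
      using contH unfolding eq by (rule continuous_on_compose2) (auto intro: continuous_intros)
    then show "retraction_maps (top_of_set (word_space K)) (top_of_set (word_space ?L)) (\<lambda>p. H (1, p)) id"
      using H1 \<open>word_space ?L \<subseteq> word_space K\<close> by (auto simp: retraction_maps_def H_def)
  qed
qed

definition all_words :: "'a set \<Rightarrow> 'a list set" where
  "all_words C = {w. distinct w \<and> set w \<subseteq> C}"

definition matched_words :: "'a set \<Rightarrow> 'a list set" where
  "matched_words C = {w. \<exists>r v v'. matched C r v v' \<and> (w = v \<or> w = v')}"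

lemma finite_all_words: "finite C \<Longrightarrow> finite (all_words C)"
  unfolding all_words_def using finite_subset_distinct[of C]
  by (simp add: conj_commute)

lemma word_complex_all_words: "finite C \<Longrightarrow> word_complex (all_words C)"
  using finite_all_words[of C] subseq_imp_distinct subseq_imp_subset
  unfolding word_complex_def by (fastforce simp: all_words_def)

lemma matched_words_subset: "matched_words C \<subseteq> all_words C"
  using matched_word matched_subseq subseq_imp_distinct subseq_imp_subset
  unfolding matched_words_def all_words_def by (smt (verit, best) mem_Collect_eq subset_iff)

lemma unmatched_full:
  assumes "finite C" "w \<in> all_words C" "w \<notin> matched_words C"
  shows "set w = C"
  using assms matched_total[of C w] by (auto simp: all_words_def matched_words_def)

lemma proper_subword_matched:
  assumes "finite C" "w \<in> all_words C" "subseq v w" "v \<noteq> w"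
  shows "v \<in> matched_words C"
proof (rule ccontr)
  assume "v \<notin> matched_words C"
  moreover have v: "v \<in> all_words C" using word_complex_all_words assms unfolding word_complex_def by blast
  ultimately have "set v = C" using unmatched_full assms by blast
  then have "length v = card C" using v by (metis (mono_tags) all_words_def distinct_card mem_Collect_eq)
  moreover have "length w \<le> card C"
    using assms(1,2) by (metis (mono_tags) all_words_def card_mono distinct_card mem_Collect_eq)
  ultimately show False using subseq_length_less[OF assms(3,4)] by simp
qed

lemma word_complex_matched_words: "finite C \<Longrightarrow> word_complex (matched_words C)"
  using word_complex_all_words[of C] matched_words_subset[of C] proper_subword_matched[of C]
    finite_subset[of "matched_words C" "all_words C"]
  unfolding word_complex_def by (metis subsetD)

lemma weights_Nil [simp]: "weights [] = {}"
  by (auto simp: weights_def)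

lemma cell_singleton: "\<exists>p. cell [x] = {p}"
proof -
  have "weights [x] = {\<lambda>c. if c = x then 1 else 0}"
    by (auto simp: weights_def)
  then show ?thesis by (simp add: cell_def)
qed

text \<open>Remove a pair of maximal rank, other than the pair of the empty word.  A word of the complex that has the smaller member of the pair
  as a proper subword belongs to a pair of larger rank, unless it is the other member; so the
  pair is an elementary collapse and the remaining words again form a perfectly matched
  complex.\<close>

lemma contractible_perfectly_matched:
  assumes "finite C" "word_complex K" "K \<noteq> {}"
    and "\<And>w. w \<in> K \<Longrightarrow> \<exists>r v v'. matched C r v v' \<and> v \<in> K \<and> v' \<in> K \<and> (w = v \<or> w = v')"
  shows "contractible (word_space K) \<and> word_space K \<noteq> {}"
  using assms(2-4)
proof (induction "card K" arbitrary: K rule: less_induct)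
  case less
  note K = less.prems(1) and pair = less.prems(3)
  have finK: "finite K" and subK: "\<And>v w. w \<in> K \<Longrightarrow> subseq v w \<Longrightarrow> v \<in> K"
    using K by (auto simp: word_complex_def)
  have nil: "[] \<in> K" using less.prems(2) subK[of _ "[]"] by auto
  \<comment> \<open>the empty word is matched with the one-letter word \<open>[x]\<close>, the vertex that remains at the end\<close>
  obtain r0 v0 w0 where p0: "matched C r0 v0 w0" "v0 \<in> K" "w0 \<in> K" "[] = v0 \<or> [] = w0"
    using pair[OF nil] by blast
  then obtain x where x: "v0 = []" "w0 = [x]" using matched_insert[OF p0(1)] by auto
  define rk where "rk w = (SOME r. \<exists>v v'. matched C r v v' \<and> (w = v \<or> w = v'))" for w
  have rk: "rk w = r" if "matched C r v v'" "w = v \<or> w = v'" for r v v' w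
    unfolding rk_def
  proof (rule some_equality)
    show "\<exists>v v'. matched C r v v' \<and> (w = v \<or> w = v')" using that by blast
    fix q assume "\<exists>v v'. matched C q v v' \<and> (w = v \<or> w = v')"
    then obtain u u' where u: "matched C q u u'" "w = u \<or> w = u'" by blast
    have "u = v \<or> u = v' \<or> u' = v \<or> u' = v'" using u(2) that(2) by auto
    from matched_unique[OF u(1) that(1) this] show "q = r" by (rule conjunct1)
  qed
  show ?case
  proof (cases "K = {[], [x]}")
    case True
    obtain p where p: "cell [x] = {p}" using cell_singleton[of x] by (rule exE)
    have "word_space K = cell [] \<union> cell [x]" unfolding True word_space_def by simp
    then have "word_space K = {p}" using p by (simp add: cell_def[of "[]"])
    then show ?thesis by (simp flip: contractible_space_top_of_set)
  next
    case False
    let ?S = "K - {[], [x]}"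
    have S: "finite ?S" "?S \<noteq> {}" using False finK nil p0(3) x by auto
    then have "Max (rk ` ?S) \<in> rk ` ?S" by (intro Max_in) auto
    then obtain w where w: "w \<in> ?S" "rk w = Max (rk ` ?S)" by (metis imageE)
    have max: "rk u \<le> rk w" if "u \<in> ?S" for u using that S w(2) by simp
    obtain r v v' where m: "matched C r v v'" "v \<in> K" "v' \<in> K" "w = v \<or> w = v'"
      using pair w(1) by blast
    have not_first: "y \<notin> {[], [x]}" if "y = v \<or> y = v'" for y
    proof
      assume "y \<in> {[], [x]}"
      then have "v = v0 \<or> v = w0 \<or> v' = v0 \<or> v' = w0" using that x by auto
      from matched_unique[OF m(1) p0(1) this] have "v = [] \<and> v' = [x]" using x by simp
      then show False using m(4) w(1) by auto
    qed
    obtain l1 z l2 where z: "v = l1 @ l2" "v' = l1 @ z # l2" using matched_insert[OF m(1)] by blast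
    \<comment> \<open>otherwise the pair of \<open>u\<close> has larger rank than the pair of \<open>v\<close>, against maximality\<close>
    have free: "u = v \<or> u = v'" if u: "u \<in> K" "subseq v u" for u
    proof (rule ccontr)
      assume neq: "\<not> (u = v \<or> u = v')"
      obtain q y y' where q: "matched C q y y'" "u = y \<or> u = y'" using pair[OF u(1)] by blast
      have "subseq v y'" using q u(2) matched_subseq subseq_order.trans by blast
      moreover have "v \<noteq> y" "v \<noteq> y'" using matched_unique[OF m(1) q(1)] q(2) neq by blast+
      ultimately obtain q' a a' where "matched C q' a a'" "v = a \<or> v = a'" "q' < q"
        using matched_subword_rank[OF q(1) assms(1)] by blast
      then have "rk v < rk u" using rk q by metis
      moreover have "rk v = rk w" using rk m by metis
      moreover have "u \<in> ?S"
      proof -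
        have "u \<noteq> []" using u(2) not_first by auto
        moreover have "u \<noteq> [x]"
          using u(2) not_first[of v] neq subseq_length_less[of v "[x]"] by auto
        ultimately show ?thesis using u(1) by blast
      qed
      ultimately show False using max by fastforce
    qed
    let ?L = "K - {v, v'}"
    have "word_complex ?L"
      unfolding word_complex_def
    proof (intro conjI ballI allI impI)
      fix u y assume u: "u \<in> ?L" "subseq y u"
      have "y \<noteq> v" "y \<noteq> v'"
        using u free[of u] matched_subseq[OF m(1)] subseq_order.trans by blast+
      then show "y \<in> ?L" using u subK by blast
    qed (use K in \<open>auto simp: word_complex_def\<close>)
    moreover have "?L \<noteq> {}" using nil not_first by blast
    moreover have "\<exists>r y y'. matched C r y y' \<and> y \<in> ?L \<and> y' \<in> ?L \<and> (u = y \<or> u = y')"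
      if u: "u \<in> ?L" for u
    proof -
      obtain q y y' where q: "matched C q y y'" "y \<in> K" "y' \<in> K" "u = y \<or> u = y'"
        using pair[of u] u by blast
      then have "y \<notin> {v, v'} \<and> y' \<notin> {v, v'}" using matched_unique[OF m(1) q(1)] q(4) u by blast
      then show ?thesis using q by blast
    qed
    moreover have "card ?L < card K" using m(2) finK by (intro psubset_card_mono) auto
    ultimately have L: "contractible (word_space ?L) \<and> word_space ?L \<noteq> {}"
      using less.hyps by blast
    have "top_of_set (word_space K) homotopy_equivalent_space top_of_set (word_space ?L)"
      using elementary_collapse[OF K m(3) z(2) z(1) _ free] not_first by blast
    then have "contractible (word_space K)"
      using L homotopy_equivalent_space_contractibility contractible_space_top_of_set by blast
    then show ?thesis using L word_space_mono[of ?L K] by blast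
  qed
qed

lemma contractible_matched_words:
  assumes "finite C" "C \<noteq> {}"
  shows "contractible (word_space (matched_words C))" "word_space (matched_words C) \<noteq> {}"
proof -
  have "matched C (squash (length ([]::'a list))) [] [pivot C]"
    using assms by (intro matched.front) auto
  then have "matched_words C \<noteq> {}" by (auto simp: matched_words_def)
  moreover have "\<exists>r v v'. matched C r v v' \<and> v \<in> matched_words C \<and> v' \<in> matched_words C \<and> (w = v \<or> w = v')"
    if "w \<in> matched_words C" for w
    using that unfolding matched_words_def by blast
  ultimately have "contractible (word_space (matched_words C)) \<and> word_space (matched_words C) \<noteq> {}"
    by (rule contractible_perfectly_matched[OF assms(1) word_complex_matched_words[OF assms(1)]])
  then show "contractible (word_space (matched_words C))" "word_space (matched_words C) \<noteq> {}" by auto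
qed

section \<open>Mapping a simplex onto a sphere\<close>

definition min_weight :: "nat \<Rightarrow> (nat \<Rightarrow> real) \<Rightarrow> real" where
  "min_weight m y = Min (y ` {..m})"

lemma continuous_on_min_weight: "continuous_on S (min_weight m)"
  unfolding min_weight_def[abs_def]
  by (rule continuous_on_Min_image) (auto intro: continuous_on_subset[OF continuous_on_product_coordinates])

lemma min_weight_le: "k \<le> m \<Longrightarrow> min_weight m y \<le> y k"
  by (simp add: min_weight_def)

lemma min_weight_attained: "\<exists>k\<le>m. min_weight m y = y k"
proof -
  have "Min (y ` {..m}) \<in> y ` {..m}" by (rule Min_in) auto
  then obtain k where "k \<le> m" "Min (y ` {..m}) = y k" by (metis imageE atMost_iff)
  then show ?thesis unfolding min_weight_def by blast
qed

lemma min_weight_eqI: "k \<le> m \<Longrightarrow> y k = s \<Longrightarrow> (\<And>i. i \<le> m \<Longrightarrow> s \<le> y i) \<Longrightarrow> min_weight m y = s"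
  unfolding min_weight_def by (rule Min_eqI) auto

lemma min_weight_bounds:
  assumes "y \<in> standard_simplex m"
  shows "0 \<le> min_weight m y" "real (Suc m) * min_weight m y \<le> 1"
proof -
  show "0 \<le> min_weight m y"
    using min_weight_attained[of m y] assms by (auto simp: standard_simplex_def)
  have "(\<Sum>k\<le>m. min_weight m y) \<le> (\<Sum>k\<le>m. y k)"
    by (intro sum_mono min_weight_le) auto
  then show "real (Suc m) * min_weight m y \<le> 1"
    using assms by (simp add: standard_simplex_def)
qed

lemma standard_simplexI:
  assumes "\<And>k. k \<le> m \<Longrightarrow> 0 \<le> y k" "\<And>k. m < k \<Longrightarrow> y k = 0" "(\<Sum>k\<le>m. y k) = 1"
  shows "y \<in> standard_simplex m"
proof -
  have "y k \<le> 1" if "k \<le> m" for k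
    using member_le_sum[of k "{..m}" y] assms that by auto
  then show ?thesis
    using assms unfolding standard_simplex_def
    by (auto simp: not_le) (metis le_less_linear order_refl, metis le_less_linear zero_le_one)
qed

definition squared_offset :: "nat \<Rightarrow> (nat \<Rightarrow> real) \<Rightarrow> real" where
  "squared_offset m y = (\<Sum>i=1..m. (y i - y 0)\<^sup>2)"

text \<open>With \<open>s\<close> the smallest coordinate of \<open>y\<close> and \<open>b\<close> the vector of differences \<open>y i - y 0\<close> for
  \<open>1 \<le> i \<le> m\<close>, this is the inverse stereographic projection of \<open>b / s\<close>, written without dividing
  by \<open>s\<close>.  It makes sense on the whole simplex, since \<open>b\<close> and \<open>s\<close> do not vanish together, and it
  sends the boundary, where \<open>s = 0\<close>, to the pole.\<close>

definition simplex_to_sphere :: "nat \<Rightarrow> (nat \<Rightarrow> real) \<Rightarrow> nat \<Rightarrow> real" where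
  "simplex_to_sphere m y =
     (\<lambda>i. if i = 0 then (squared_offset m y - (min_weight m y)\<^sup>2) / (squared_offset m y + (min_weight m y)\<^sup>2)
          else if i \<le> m then 2 * min_weight m y * (y i - y 0) / (squared_offset m y + (min_weight m y)\<^sup>2)
          else 0)"

abbreviation pole :: "nat \<Rightarrow> real" where
  "pole \<equiv> (\<lambda>k. if k = 0 then 1 else 0)"

lemma squared_offset_plus_min_weight_pos:
  assumes "y \<in> standard_simplex m"
  shows "0 < squared_offset m y + (min_weight m y)\<^sup>2"
proof -
  have nn: "0 \<le> squared_offset m y" by (auto simp: squared_offset_def intro: sum_nonneg)
  have "\<not> (squared_offset m y = 0 \<and> min_weight m y = 0)"
  proof
    assume *: "squared_offset m y = 0 \<and> min_weight m y = 0"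
    then have "\<forall>i\<in>{1..m}. (y i - y 0)\<^sup>2 = 0"
      unfolding squared_offset_def by (subst sum_nonneg_eq_0_iff[symmetric]) auto
    then have eq: "y i = y 0" if "i \<le> m" for i using that by (cases "i = 0") auto
    then have "y i = 0" if "i \<le> m" for i
      using min_weight_attained[of m y] * that by (metis eq)
    then have "(\<Sum>k\<le>m. y k) = 0" by simp
    then show False using assms by (simp add: standard_simplex_def)
  qed
  then show ?thesis using nn by (metis add_nonneg_eq_0_iff add_nonneg_nonneg less_eq_real_def power2_eq_iff zero_eq_power2 zero_le_power2)
qed

lemma sum_atMost_split: "(\<Sum>i\<le>m. f i) = f 0 + (\<Sum>i=1..m. f i)" for f :: "nat \<Rightarrow> real"
  by (simp add: sum.atMost_shift sum.atLeast1_atMost_eq lessThan_atLeast0 flip: atLeast0LessThan)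

lemma simplex_to_sphere_in_nsphere:
  assumes "y \<in> standard_simplex m"
  shows "simplex_to_sphere m y \<in> topspace (nsphere m)"
proof -
  define A s where "A = squared_offset m y" and "s = min_weight m y"
  have D: "A + s\<^sup>2 > 0" using squared_offset_plus_min_weight_pos[OF assms] by (simp add: A_def s_def)
  have "(\<Sum>i\<le>m. (simplex_to_sphere m y i)\<^sup>2)
      = ((A - s\<^sup>2) / (A + s\<^sup>2))\<^sup>2 + (\<Sum>i=1..m. (2 * s / (A + s\<^sup>2))\<^sup>2 * (y i - y 0)\<^sup>2)"
    unfolding sum_atMost_split
    by (auto simp: simplex_to_sphere_def A_def s_def power_mult_distrib power_divide intro!: sum.cong)
  also have "\<dots> = ((A - s\<^sup>2) / (A + s\<^sup>2))\<^sup>2 + (2 * s / (A + s\<^sup>2))\<^sup>2 * A"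
    by (simp add: A_def squared_offset_def sum_distrib_left)
  also have "\<dots> = 1"
    using D by (simp add: power_divide divide_simps) (simp add: power2_eq_square algebra_simps)
  finally show ?thesis by (simp add: nsphere) (simp add: simplex_to_sphere_def)
qed

lemma simplex_to_sphere_eq_pole:
  assumes "y \<in> standard_simplex m"
  shows "simplex_to_sphere m y = pole \<longleftrightarrow> min_weight m y = 0"
proof
  assume "simplex_to_sphere m y = pole"
  then have "simplex_to_sphere m y 0 = 1" by simp
  then show "min_weight m y = 0"
    using squared_offset_plus_min_weight_pos[OF assms] by (simp add: simplex_to_sphere_def divide_simps split: if_splits)
next
  assume "min_weight m y = 0"
  then show "simplex_to_sphere m y = pole"
    using squared_offset_plus_min_weight_pos[OF assms] by (auto simp: simplex_to_sphere_def)
qed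

text \<open>Equal images mean equal quotients \<open>b / s\<close>.  Then \<open>z\<close> is the image of \<open>y\<close> under an affine map
  with factor \<open>k\<close> in every coordinate; comparing minima shows that its constant term is \<open>0\<close>, and
  comparing sums that \<open>k = 1\<close>.\<close>

lemma simplex_to_sphere_inj:
  assumes y: "y \<in> standard_simplex m" and z: "z \<in> standard_simplex m"
    and eq: "simplex_to_sphere m y = simplex_to_sphere m z" and pos: "min_weight m y \<noteq> 0"
  shows "y = z"
proof -
  have posz: "min_weight m z \<noteq> 0"
    using simplex_to_sphere_eq_pole[OF y] simplex_to_sphere_eq_pole[OF z] eq pos by auto
  have quot: "simplex_to_sphere m x i / (1 - simplex_to_sphere m x 0) = (x i - x 0) / min_weight m x"
    if "x \<in> standard_simplex m" "min_weight m x \<noteq> 0" "0 < i" "i \<le> m" for x i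
  proof -
    define A s where "A = squared_offset m x" and "s = min_weight m x"
    have D: "A + s\<^sup>2 > 0" using squared_offset_plus_min_weight_pos[OF that(1)] by (simp add: A_def s_def)
    have "1 - (A - s\<^sup>2) / (A + s\<^sup>2) = 2 * s\<^sup>2 / (A + s\<^sup>2)"
      using D by (simp add: divide_simps)
    then show ?thesis
      using that D by (simp add: simplex_to_sphere_def flip: A_def s_def) (simp add: power2_eq_square)
  qed
  define k where "k = min_weight m z / min_weight m y"
  have kpos: "0 < k"
    using min_weight_bounds(1)[OF y] min_weight_bounds(1)[OF z] pos posz by (simp add: k_def)
  have aff: "z i = k * y i + (z 0 - k * y 0)" if "i \<le> m" for i
  proof (cases "i = 0")
    case False
    then have "(y i - y 0) / min_weight m y = (z i - z 0) / min_weight m z"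
      using quot[OF y pos, of i] quot[OF z posz, of i] eq that by simp
    then show ?thesis using pos posz by (simp add: k_def field_simps)
  qed simp
  have "min_weight m z = k * min_weight m y + (z 0 - k * y 0)"
  proof -
    obtain i where i: "i \<le> m" "min_weight m y = y i" using min_weight_attained by blast
    show ?thesis
    proof (rule min_weight_eqI[OF i(1)])
      show "z i = k * min_weight m y + (z 0 - k * y 0)"
        unfolding i(2) by (rule aff[OF i(1)])
      show "k * min_weight m y + (z 0 - k * y 0) \<le> z j" if "j \<le> m" for j
        using aff[OF that] mult_left_mono[OF min_weight_le[OF that, of y], of k] kpos by linarith
    qed
  qed
  then have "z 0 - k * y 0 = 0" using pos by (simp add: k_def)
  then have zk: "z i = k * y i" if "i \<le> m" for i using aff[OF that] by simp
  have "(\<Sum>i\<le>m. z i) = k * (\<Sum>i\<le>m. y i)"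
    by (simp add: zk sum_distrib_left)
  then have "k = 1" using y z by (simp add: standard_simplex_def)
  have "y i = z i" for i
  proof (cases "i \<le> m")
    case True
    then show ?thesis using zk \<open>k = 1\<close> by simp
  next
    case False
    then show ?thesis using y z by (simp add: standard_simplex_def)
  qed
  then show ?thesis by blast
qed

lemma simplex_to_sphere_surj:
  assumes x: "x \<in> topspace (nsphere m)" and ne: "x \<noteq> pole"
  shows "\<exists>y\<in>standard_simplex m. simplex_to_sphere m y = x"
proof -
  have sq: "(\<Sum>i\<le>m. (x i)\<^sup>2) = 1" and out: "\<And>i. m < i \<Longrightarrow> x i = 0"
    using x by (auto simp: nsphere)
  define R where "R = (\<Sum>i=1..m. (x i)\<^sup>2)"
  have R: "R = 1 - (x 0)\<^sup>2" using sq by (simp add: sum_atMost_split R_def)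
  have "0 \<le> R" by (auto simp: R_def intro: sum_nonneg)
  then have "(x 0)\<^sup>2 \<le> 1" using R by linarith
  then have "x 0 \<le> 1" unfolding abs_square_le_1 by linarith
  moreover have "x 0 \<noteq> 1"
  proof
    assume 1: "x 0 = 1"
    then have "\<forall>i\<in>{1..m}. (x i)\<^sup>2 = 0"
      using R unfolding R_def by (subst sum_nonneg_eq_0_iff[symmetric]) auto
    then have "x i = (if i = 0 then 1 else 0)" for i
      using 1 out by (cases "i = 0"; cases "i \<le> m") auto
    then show False using ne by blast
  qed
  ultimately have x0: "x 0 < 1" by simp
  \<comment> \<open>\<open>w\<close> is the stereographic projection of \<open>x\<close>; shifting and rescaling it so that the minimum
    becomes \<open>s\<close> and the sum \<open>1\<close> gives the preimage \<open>y\<close>\<close>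
  define w where "w = (\<lambda>i. if i = 0 then 0 else x i / (1 - x 0))"
  define \<mu> where "\<mu> = min_weight m w"
  define s where "s = 1 / (\<Sum>i\<le>m. 1 - \<mu> + w i)"
  define y where "y = (\<lambda>i. if i \<le> m then s * (1 - \<mu> + w i) else 0)"
  have ge1: "1 \<le> 1 - \<mu> + w i" if "i \<le> m" for i
    using min_weight_le[OF that, of w] by (simp add: \<mu>_def)
  have "0 < (\<Sum>i\<le>m. 1 - \<mu> + w i)"
    using ge1 by (intro sum_pos) (auto intro: less_le_trans[OF zero_less_one])
  then have s: "0 < s" "s * (\<Sum>i\<le>m. 1 - \<mu> + w i) = 1" by (auto simp: s_def)
  have yS: "y \<in> standard_simplex m"
  proof (rule standard_simplexI)
    show "0 \<le> y k" if "k \<le> m" for k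
      using s(1) order_trans[OF zero_le_one ge1[OF that]] that by (simp add: y_def)
    show "(\<Sum>k\<le>m. y k) = 1"
      using s(2) by (simp add: y_def sum_distrib_left)
  qed (simp add: y_def)
  have mw: "min_weight m y = s"
  proof -
    obtain i where i: "i \<le> m" "\<mu> = w i" using min_weight_attained unfolding \<mu>_def by blast
    show ?thesis
      by (rule min_weight_eqI[OF i(1)]) (use i s(1) ge1 in \<open>auto simp: y_def\<close>)
  qed
  have diff: "y i - y 0 = s * w i" if "i \<le> m" for i
    using that by (simp add: y_def w_def algebra_simps)
  have sp: "squared_offset m y = s\<^sup>2 * ((1 + x 0) / (1 - x 0))"
  proof -
    have "squared_offset m y = (\<Sum>i=1..m. s\<^sup>2 / (1 - x 0)\<^sup>2 * (x i)\<^sup>2)"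
      unfolding squared_offset_def by (rule sum.cong) (auto simp: diff w_def power_mult_distrib power_divide)
    also have "\<dots> = s\<^sup>2 / (1 - x 0)\<^sup>2 * (1 - (x 0)\<^sup>2)"
      by (simp only: R_def[symmetric] sum_distrib_left[symmetric] R)
    also have "\<dots> = s\<^sup>2 * ((1 + x 0) / (1 - x 0))"
      using x0 by (simp add: divide_simps) (simp add: power2_eq_square algebra_simps)
    finally show ?thesis .
  qed
  have D: "squared_offset m y + s\<^sup>2 = 2 * s\<^sup>2 / (1 - x 0)" and E: "squared_offset m y - s\<^sup>2 = 2 * s\<^sup>2 * x 0 / (1 - x 0)"
    using x0 by (auto simp: sp divide_simps algebra_simps)
  have "simplex_to_sphere m y i = x i" for i
  proof (cases "i = 0 \<or> m < i")
    case True
    then show ?thesis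
      using x0 s(1) out by (auto simp: simplex_to_sphere_def mw D E)
  next
    case False
    then have "simplex_to_sphere m y i = 2 * s * (s * w i) / (2 * s\<^sup>2 / (1 - x 0))"
      by (simp add: simplex_to_sphere_def mw D diff)
    also have "\<dots> = x i"
      using x0 s(1) False by (simp add: w_def power2_eq_square)
    finally show ?thesis .
  qed
  then show ?thesis using yS by blast
qed

lemma continuous_on_simplex_to_sphere: "continuous_on (standard_simplex m) (simplex_to_sphere m)"
proof (rule continuous_on_coordinatewise_then_product)
  fix i
  have c: "continuous_on (standard_simplex m) (\<lambda>y. squared_offset m y)"
    unfolding squared_offset_def by (intro continuous_intros continuous_on_coordinate)
  have n: "\<forall>y\<in>standard_simplex m. squared_offset m y + (min_weight m y)\<^sup>2 \<noteq> 0"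
    using squared_offset_plus_min_weight_pos by (metis less_irrefl)
  consider "i = 0" | "i \<noteq> 0" "i \<le> m" | "i \<noteq> 0" "\<not> i \<le> m" by blast
  then show "continuous_on (standard_simplex m) (\<lambda>y. simplex_to_sphere m y i)"
  proof cases
    case 1
    then show ?thesis
      by (simp add: simplex_to_sphere_def)
        (intro continuous_on_divide continuous_on_diff continuous_on_add continuous_on_power
          continuous_on_min_weight c n)
  next
    case 2
    then show ?thesis
      by (simp add: simplex_to_sphere_def)
        (intro continuous_on_divide continuous_on_diff continuous_on_mult continuous_on_add continuous_on_power
          continuous_on_const continuous_on_min_weight continuous_on_coordinate c n)
  next
    case 3
    then show ?thesis by (simp add: simplex_to_sphere_def)
  qed
qed

lemma continuous_map_simplex_to_sphere:
  "continuous_map (top_of_set (standard_simplex m)) (nsphere m) (simplex_to_sphere m)"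
  using continuous_on_simplex_to_sphere simplex_to_sphere_in_nsphere
  by (auto simp: nsphere euclidean_product_topology)

lemma quotient_map_simplex_to_sphere:
  assumes "0 < m"
  shows "quotient_map (top_of_set (standard_simplex m)) (nsphere m) (simplex_to_sphere m)"
proof (rule T1_Spaces.continuous_imp_quotient_map)
  have e: "subtopology (powertop_real UNIV) S = top_of_set S" for S :: "(nat \<Rightarrow> real) set"
    by (simp add: euclidean_product_topology)
  show "continuous_map (top_of_set (standard_simplex m)) (nsphere m) (simplex_to_sphere m)"
    by (rule continuous_map_simplex_to_sphere)
  show "compact_space (top_of_set (standard_simplex m))"
    using compactin_standard_simplex[of m] by (simp add: compactin_subspace e)
  show "Hausdorff_space (nsphere m)"
    unfolding nsphere by (intro Hausdorff_space_subtopology) (simp add: Hausdorff_space_product_topology)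
  have "pole = simplex_to_sphere m pole"
  proof -
    have "pole \<in> standard_simplex m" by (rule standard_simplexI) auto
    moreover from this have "min_weight m pole = 0"
      using min_weight_bounds(1)[of pole m] min_weight_le[of 1 m pole] assms by simp
    ultimately show ?thesis using simplex_to_sphere_eq_pole by metis
  qed
  moreover have "pole \<in> standard_simplex m" by (rule standard_simplexI) auto
  ultimately have "x \<in> simplex_to_sphere m ` standard_simplex m" if "x \<in> topspace (nsphere m)" for x
    using simplex_to_sphere_surj[OF that] by (cases "x = pole") (auto intro: image_eqI)
  then show "simplex_to_sphere m ` topspace (top_of_set (standard_simplex m)) = topspace (nsphere m)"
    using simplex_to_sphere_in_nsphere by auto
qed

section \<open>Attaching simplices to a contractible space\<close>

text \<open>If \<open>f\<close> collapses \<open>Z\<close> to a point and nothing else, and a homotopy of \<open>X\<close> preserves \<open>Z\<close> and ends in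
  a map that is constant on \<open>Z\<close>, then that map factors through \<open>f\<close> and yields a homotopy inverse.
  The homotopy itself descends to \<open>W\<close> because the product of a quotient map with the interval is
  again a quotient map.\<close>

lemma homotopy_equivalent_quotient_of_contracted_subset:
  assumes q: "quotient_map X W f"
    and fib: "\<And>x y. \<lbrakk>x \<in> topspace X; y \<in> topspace X; f x = f y\<rbrakk> \<Longrightarrow> x = y \<or> x \<in> Z \<and> y \<in> Z"
    and H: "continuous_map (prod_topology (top_of_set {0..1::real}) X) X H"
    and H0: "\<And>x. x \<in> topspace X \<Longrightarrow> H (0, x) = x"
    and HZ: "\<And>t z. \<lbrakk>t \<in> {0..1}; z \<in> Z\<rbrakk> \<Longrightarrow> H (t, z) \<in> Z"
    and H1: "\<And>y z. \<lbrakk>y \<in> Z; z \<in> Z\<rbrakk> \<Longrightarrow> H (1, y) = H (1, z)"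
    and fZ: "\<And>y z. \<lbrakk>y \<in> Z; z \<in> Z\<rbrakk> \<Longrightarrow> f y = f z"
  shows "X homotopy_equivalent_space W"
proof -
  have f: "continuous_map X W f" using q by (rule quotient_imp_continuous_map)
  have slice: "continuous_map X X (\<lambda>x. H (t, x))" if "t \<in> {0..1}" for t
    using continuous_map_compose[OF _ H, of X "\<lambda>x. (t, x)"] that
    by (simp add: o_def continuous_map_pairwise)
  obtain g where g: "continuous_map W X g" and gf: "\<And>x. x \<in> topspace X \<Longrightarrow> g (f x) = H (1, x)"
  proof (rule quotient_map_lift_exists[OF q slice[of 1]])
    show "H (1, x) = H (1, y)" if "x \<in> topspace X" "y \<in> topspace X" "f x = f y" for x y
      using fib[OF that] H1 by blast
  qed (auto intro: that)
  have I: "locally_compact_space (top_of_set {0..1::real})" "Hausdorff_space (top_of_set {0..1::real})"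
    by (auto intro!: compact_imp_locally_compact_space simp: compact_space_subtopology Hausdorff_space_subtopology)
  have qI: "quotient_map (prod_topology (top_of_set {0..1::real}) X)
      (prod_topology (top_of_set {0..1::real}) W) (\<lambda>(t, x). (t, f x))"
    by (rule quotient_map_prod_right) (use I q in auto)
  have fH: "continuous_map (prod_topology (top_of_set {0..1::real}) X) W (f \<circ> H)"
    using H f by (rule continuous_map_compose)
  obtain F where F: "continuous_map (prod_topology (top_of_set {0..1::real}) W) W F"
    and Ff: "\<And>p. p \<in> topspace (prod_topology (top_of_set {0..1::real}) X) \<Longrightarrow>
               F ((\<lambda>(t, x). (t, f x)) p) = (f \<circ> H) p"
  proof (rule quotient_map_lift_exists[OF qI fH])
    fix p p' assume p: "p \<in> topspace (prod_topology (top_of_set {0..1::real}) X)"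
      "p' \<in> topspace (prod_topology (top_of_set {0..1::real}) X)"
      "(\<lambda>(t, x). (t, f x)) p = (\<lambda>(t, x). (t, f x)) p'"
    then obtain t x x' where "p = (t, x)" "p' = (t, x')" "t \<in> {0..1}" "x \<in> topspace X" "x' \<in> topspace X" "f x = f x'"
      by (cases p; cases p') auto
    then show "(f \<circ> H) p = (f \<circ> H) p'"
      using fib[of x x'] fZ HZ by auto
  qed (auto intro: that)
  have surj: "f ` topspace X = topspace W" using q by (rule quotient_imp_surjective_map)
  have "homotopic_with (\<lambda>x. True) X X id (g \<circ> f)"
    using H H0 gf by (subst homotopic_with) (auto intro!: exI[of _ H])
  moreover have "homotopic_with (\<lambda>x. True) W W id (f \<circ> g)"
  proof (subst homotopic_with, simp, intro exI conjI ballI)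
    fix w assume "w \<in> topspace W"
    then obtain x where x: "x \<in> topspace X" "w = f x" using surj by blast
    show "F (0, w) = id w" using Ff[of "(0, x)"] x H0 by simp
    show "F (1, w) = (f \<circ> g) w" using Ff[of "(1, x)"] x gf by simp
  qed (use F in auto)
  ultimately show ?thesis
    unfolding homotopy_equivalent_space_def using f g by (metis homotopic_with_sym)
qed

text \<open>The pair of \<open>collar_push\<close> and \<open>collar_time\<close> is a retraction of the product of a simplex with the
  interval onto the union of the bottom (time \<open>0\<close>) and the sides (boundary of the simplex).  At
  time \<open>t\<close>, the points whose smallest coordinate is at least \<open>t / (2 * (m + 1))\<close> form a smaller
  copy of the simplex, which is expanded to the whole simplex; the collar around it is
  projected radially from the barycentre to the boundary, while the time decreases from \<open>t\<close> on the
  boundary to \<open>0\<close> at the inner edge.  The factor \<open>2\<close> keeps the smaller copy from shrinking to the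
  barycentre, where the projection is undefined.\<close>

definition collar_depth :: "nat \<Rightarrow> real \<Rightarrow> (nat \<Rightarrow> real) \<Rightarrow> real" where
  "collar_depth m t y = min (min_weight m y) (t / (2 * real (Suc m)))"

definition collar_push :: "nat \<Rightarrow> real \<Rightarrow> (nat \<Rightarrow> real) \<Rightarrow> nat \<Rightarrow> real" where
  "collar_push m t y =
     (\<lambda>k. if k \<le> m then (y k - collar_depth m t y) / (1 - real (Suc m) * collar_depth m t y) else 0)"

definition collar_time :: "nat \<Rightarrow> real \<Rightarrow> (nat \<Rightarrow> real) \<Rightarrow> real" where
  "collar_time m t y = t - 2 * real (Suc m) * collar_depth m t y"

context
  fixes m :: nat and t :: real and y :: "nat \<Rightarrow> real"
  assumes t: "t \<in> {0..1}" and y: "y \<in> standard_simplex m"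
begin

lemma collar_depth_bounds:
  "0 \<le> collar_depth m t y" "collar_depth m t y \<le> min_weight m y"
  "real (Suc m) * collar_depth m t y \<le> t / 2"
proof -
  show "0 \<le> collar_depth m t y" "collar_depth m t y \<le> min_weight m y"
    using t min_weight_bounds(1)[OF y] by (auto simp: collar_depth_def)
  have "real (Suc m) * collar_depth m t y \<le> real (Suc m) * (t / (2 * real (Suc m)))"
    by (intro mult_left_mono) (auto simp: collar_depth_def)
  also have "\<dots> = t / 2" by (simp add: field_simps del: of_nat_Suc)
  finally show "real (Suc m) * collar_depth m t y \<le> t / 2" .
qed

lemma collar_denominator_pos: "0 < 1 - real (Suc m) * collar_depth m t y"
  using collar_depth_bounds(3) t by auto

lemma collar_push_in_simplex: "collar_push m t y \<in> standard_simplex m"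
proof (rule standard_simplexI)
  let ?d = "collar_depth m t y"
  show "0 \<le> collar_push m t y k" if "k \<le> m" for k
    using that collar_depth_bounds(2) min_weight_le[OF that, of y] collar_denominator_pos
    by (simp add: collar_push_def del: of_nat_Suc)
  have "(\<Sum>k\<le>m. collar_push m t y k) = (\<Sum>k\<le>m. y k - ?d) / (1 - real (Suc m) * ?d)"
    by (simp add: collar_push_def sum_divide_distrib)
  also have "(\<Sum>k\<le>m. y k - ?d) = 1 - real (Suc m) * ?d"
    using y by (simp add: sum_subtractf standard_simplex_def)
  finally show "(\<Sum>k\<le>m. collar_push m t y k) = 1"
    using collar_denominator_pos by simp
qed (simp add: collar_push_def)

lemma collar_time_bounds: "collar_time m t y \<in> {0..1}"
proof -
  have "0 \<le> real (Suc m) * collar_depth m t y"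
    using collar_depth_bounds(1) by (intro mult_nonneg_nonneg) auto
  then show ?thesis
    using collar_depth_bounds(3) t unfolding collar_time_def by (auto simp del: of_nat_Suc)
qed

lemma collar_push_boundary:
  assumes "min_weight m y \<le> t / (2 * real (Suc m))"
  shows "min_weight m (collar_push m t y) = 0"
proof -
  have d: "collar_depth m t y = min_weight m y" using assms by (simp add: collar_depth_def)
  obtain k where "k \<le> m" "min_weight m y = y k" using min_weight_attained by blast
  then have "collar_push m t y k = 0" by (simp add: collar_push_def d)
  moreover have "0 \<le> collar_push m t y i" for i
    using collar_push_in_simplex by (simp add: standard_simplex_def)
  ultimately show ?thesis using \<open>k \<le> m\<close> by (intro min_weight_eqI[of k])
qed

lemma collar_time_interior:
  assumes "t / (2 * real (Suc m)) \<le> min_weight m y"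
  shows "collar_time m t y = 0"
  using assms by (simp add: collar_time_def collar_depth_def field_simps min_absorb2 del: of_nat_Suc)

lemma collar_on_boundary:
  assumes "min_weight m y = 0"
  shows "collar_push m t y = y" "collar_time m t y = t"
proof -
  have d: "collar_depth m t y = 0" using assms t by (simp add: collar_depth_def)
  show "collar_push m t y = y" "collar_time m t y = t"
    using y by (auto simp: collar_push_def collar_time_def d standard_simplex_def)
qed

lemma collar_at_start:
  assumes "t = 0"
  shows "collar_push m t y = y"
proof -
  have d: "collar_depth m t y = 0"
    using assms min_weight_bounds(1)[OF y] by (simp add: collar_depth_def)
  show ?thesis
    using y by (auto simp: collar_push_def d standard_simplex_def)
qed

end

lemma continuous_on_collar_depth:
  "continuous_on S (\<lambda>p. collar_depth m (fst p) (snd p))"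
  unfolding collar_depth_def
  by (intro continuous_on_min continuous_intros continuous_on_compose2[OF continuous_on_min_weight[of UNIV]]) auto

lemma continuous_on_collar_push:
  "continuous_on ({0..1} \<times> standard_simplex m) (\<lambda>p. collar_push m (fst p) (snd p))"
proof (rule continuous_on_coordinatewise_then_product)
  fix k
  have c: "continuous_on S (\<lambda>p. snd p k)" for S :: "(real \<times> (nat \<Rightarrow> real)) set"
    by (rule continuous_on_compose2[OF continuous_on_coordinate[of UNIV k]]) (auto intro: continuous_intros)
  have n: "\<forall>p\<in>{0..1} \<times> standard_simplex m. 1 - real (Suc m) * collar_depth m (fst p) (snd p) \<noteq> 0"
    using collar_denominator_pos by fastforce
  show "continuous_on ({0..1} \<times> standard_simplex m) (\<lambda>p. collar_push m (fst p) (snd p) k)"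
    unfolding collar_push_def using n
    by (cases "k \<le> m")
      (simp_all del: of_nat_Suc add: continuous_on_divide continuous_on_diff continuous_on_mult
        c continuous_on_collar_depth)
qed

lemma continuous_on_collar_time:
  "continuous_on S (\<lambda>p. collar_time m (fst p) (snd p))"
  unfolding collar_time_def by (intro continuous_intros continuous_on_collar_depth)

text \<open>A space \<open>X\<close> that is a closed set \<open>Z\<close> with finitely many \<open>m\<close>-simplices attached along their
  boundaries.  The charts make the simplices embedded and provide the coordinates in which maps
  on \<open>X\<close> are defined.\<close>

locale attached_simplices =
  fixes X Z :: "'p::topological_space set" and J :: "'j set" and m :: nat
    and e :: "'j \<Rightarrow> (nat \<Rightarrow> real) \<Rightarrow> 'p" and chart :: "'j \<Rightarrow> 'p \<Rightarrow> nat \<Rightarrow> real"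
  assumes finite_J: "finite J"
    and Z_subset: "Z \<subseteq> X" and closed_Z: "closedin (top_of_set X) Z"
    and closedin_cell: "\<And>j. j \<in> J \<Longrightarrow> closedin (top_of_set X) (e j ` standard_simplex m)"
    and cover: "X = Z \<union> (\<Union>j\<in>J. e j ` standard_simplex m)"
    and cont_e: "\<And>j. j \<in> J \<Longrightarrow> continuous_on (standard_simplex m) (e j)"
    and cont_chart: "\<And>j. j \<in> J \<Longrightarrow> continuous_on X (chart j)"
    and chart_e: "\<And>j y. \<lbrakk>j \<in> J; y \<in> standard_simplex m\<rbrakk> \<Longrightarrow> chart j (e j y) = y"
    and boundary: "\<And>j y. \<lbrakk>j \<in> J; y \<in> standard_simplex m\<rbrakk> \<Longrightarrow> e j y \<in> Z \<longleftrightarrow> min_weight m y = 0"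
    and disjoint_interiors: "\<And>i j y z. \<lbrakk>i \<in> J; j \<in> J; y \<in> standard_simplex m; z \<in> standard_simplex m;
          e i y = e j z; i \<noteq> j\<rbrakk> \<Longrightarrow> e i y \<in> Z"
begin

lemma e_in_X: "j \<in> J \<Longrightarrow> y \<in> standard_simplex m \<Longrightarrow> e j y \<in> X"
  using cover by auto

text \<open>The space \<open>T\<close> stands for \<open>X\<close> or for its product with the interval, with the cover by \<open>Z\<close> and the
  simplices or by their products with the interval.\<close>

lemma paste_over_cells:
  assumes X': "closedin T Z'" "\<And>j. j \<in> J \<Longrightarrow> closedin T (G j)" "topspace T \<subseteq> Z' \<union> (\<Union>j\<in>J. G j)"
    and f: "continuous_map (subtopology T Z') Y f"
    and g: "\<And>j. j \<in> J \<Longrightarrow> continuous_map (subtopology T (G j)) Y (g j)"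
    and fg: "\<And>j x. \<lbrakk>j \<in> J; x \<in> Z'; x \<in> G j\<rbrakk> \<Longrightarrow> f x = g j x"
    and gg: "\<And>i j x. \<lbrakk>i \<in> J; j \<in> J; i \<noteq> j; x \<in> G i; x \<in> G j\<rbrakk> \<Longrightarrow> x \<in> Z'"
  obtains h where "continuous_map T Y h" "\<And>x. x \<in> Z' \<Longrightarrow> h x = f x"
    "\<And>j x. j \<in> J \<Longrightarrow> x \<in> G j \<Longrightarrow> h x = g j x"
proof -
  let ?T = "case_option Z' G" and ?f = "case_option f g"
  obtain h where h: "continuous_map T Y h"
    "\<And>x i. \<lbrakk>i \<in> insert None (Some ` J); x \<in> topspace T \<inter> ?T i\<rbrakk> \<Longrightarrow> h x = ?f i x"
  proof (rule pasting_lemma_exists_closed[of "insert None (Some ` J)" T ?T Y ?f])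
    show "?f i x = ?f j x" if "i \<in> insert None (Some ` J)" "j \<in> insert None (Some ` J)"
      "x \<in> topspace T \<inter> ?T i \<inter> ?T j" for i j x
      using that fg gg[of _ _ x] by (cases i; cases j) (auto, metis)
  qed (use finite_J X' f g in auto)
  have "Z' \<subseteq> topspace T" "\<And>j. j \<in> J \<Longrightarrow> G j \<subseteq> topspace T" using X'(1,2) closedin_subset by auto
  then show ?thesis
  proof (intro that[of h] h(1))
    show "h x = f x" if "x \<in> Z'" for x
      using h(2)[of None x] that \<open>Z' \<subseteq> topspace T\<close> by auto
    show "h x = g j x" if "j \<in> J" "x \<in> G j" for j x
      using h(2)[of "Some j" x] that \<open>\<And>j. j \<in> J \<Longrightarrow> G j \<subseteq> topspace T\<close>[of j] by auto
  qed
qed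

text \<open>The homotopy extension property of \<open>Z\<close> in \<open>X\<close>: the retraction by collars reduces a point of an
  attached simplex at a given time either to time \<open>0\<close> or to a boundary point, where the given
  homotopy is defined.\<close>

lemma extend_contraction:
  assumes h: "continuous_on ({0..1} \<times> Z) h" "\<And>t z. t \<in> {0..1} \<Longrightarrow> z \<in> Z \<Longrightarrow> h (t, z) \<in> Z"
    and h0: "\<And>z. z \<in> Z \<Longrightarrow> h (0, z) = z"
  obtains H where "continuous_map (prod_topology (top_of_set {0..1::real}) (top_of_set X)) (top_of_set X) H"
    "\<And>x. x \<in> X \<Longrightarrow> H (0, x) = x" "\<And>t z. t \<in> {0..1} \<Longrightarrow> z \<in> Z \<Longrightarrow> H (t, z) = h (t, z)"
proof -
  let ?D = "standard_simplex m" and ?I = "{0..1::real}"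
  let ?gap = "\<lambda>p. min_weight m (snd p) - fst p / (2 * real (Suc m))"
  define P where "P j p = (if ?gap p \<le> 0
      then h (collar_time m (fst p) (snd p), e j (collar_push m (fst p) (snd p)))
      else e j (collar_push m (fst p) (snd p)))" for j p
  have push_Z: "e j (collar_push m t y) \<in> Z" if "j \<in> J" "t \<in> ?I" "y \<in> ?D" "?gap (t, y) \<le> 0" for j t y
    using boundary[OF that(1) collar_push_in_simplex[OF that(2,3)]]
      collar_push_boundary[OF that(2,3)] that(4) by simp
  have P_cont: "continuous_on (?I \<times> ?D) (P j)" if j: "j \<in> J" for j
    unfolding P_def
  proof (rule continuous_on_cases_le)
    have ep: "continuous_on (?I \<times> ?D) (\<lambda>p. e j (collar_push m (fst p) (snd p)))"
      by (rule continuous_on_compose2[OF cont_e[OF j] continuous_on_collar_push])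
        (auto intro: collar_push_in_simplex)
    show "continuous_on {p \<in> ?I \<times> ?D. ?gap p \<le> 0}
        (\<lambda>p. h (collar_time m (fst p) (snd p), e j (collar_push m (fst p) (snd p))))"
    proof (rule continuous_on_compose2[OF h(1)])
      show "continuous_on {p \<in> ?I \<times> ?D. ?gap p \<le> 0}
          (\<lambda>p. (collar_time m (fst p) (snd p), e j (collar_push m (fst p) (snd p))))"
        by (intro continuous_on_Pair continuous_on_collar_time continuous_on_subset[OF ep]) auto
      show "(\<lambda>p. (collar_time m (fst p) (snd p), e j (collar_push m (fst p) (snd p)))) `
          {p \<in> ?I \<times> ?D. ?gap p \<le> 0} \<subseteq> ?I \<times> Z"
        using push_Z[OF j] collar_time_bounds by auto
    qed
    show "continuous_on {p \<in> ?I \<times> ?D. 0 \<le> ?gap p} (\<lambda>p. e j (collar_push m (fst p) (snd p)))"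
      by (rule continuous_on_subset[OF ep]) auto
    show "continuous_on (?I \<times> ?D) ?gap"
      by (intro continuous_intros continuous_on_compose2[OF continuous_on_min_weight[of UNIV]]) auto
    show "h (collar_time m (fst p) (snd p), e j (collar_push m (fst p) (snd p)))
        = e j (collar_push m (fst p) (snd p))" if "p \<in> ?I \<times> ?D" "?gap p = 0" for p
    proof -
      have "fst p \<in> ?I" "snd p \<in> ?D" using that by auto
      then show ?thesis
        using h0 push_Z[OF j, of "fst p" "snd p"] collar_time_interior[of "fst p" "snd p" m] that(2) by simp
    qed
  qed
  have P_Z: "P j (t, y) = h (t, e j y)" if "j \<in> J" "t \<in> ?I" "y \<in> ?D" "e j y \<in> Z" for j t y
  proof -
    have mw: "min_weight m y = 0" using boundary that by blast
    show ?thesis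
      using collar_on_boundary[OF that(2,3) mw] mw that(2) by (simp add: P_def)
  qed
  have P_0: "P j (0, y) = e j y" if "j \<in> J" "y \<in> ?D" for j y
  proof (cases "min_weight m y = 0")
    case True
    then show ?thesis using P_Z[OF that(1) _ that(2)] h0 boundary that by auto
  next
    case False
    then have "0 < min_weight m y" using min_weight_bounds(1)[OF that(2)] by simp
    then show ?thesis using collar_at_start[of 0 y m] that by (simp add: P_def)
  qed
  have P_X: "P j (t, y) \<in> X" if "j \<in> J" "t \<in> ?I" "y \<in> ?D" for j t y
    using push_Z[OF that] h(2)[OF collar_time_bounds[OF that(2,3)]] Z_subset
      e_in_X[OF that(1) collar_push_in_simplex[OF that(2,3)]] by (auto simp: P_def)
  let ?T = "top_of_set (?I \<times> X)"
  let ?G = "\<lambda>j. ?I \<times> e j ` ?D"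
  let ?g = "\<lambda>j p. P j (fst p, chart j (snd p))"
  obtain H where H: "continuous_map ?T (top_of_set X) H" "\<And>x. x \<in> ?I \<times> Z \<Longrightarrow> H x = h x"
    "\<And>j x. j \<in> J \<Longrightarrow> x \<in> ?G j \<Longrightarrow> H x = ?g j x"
  proof (rule paste_over_cells[of ?T "?I \<times> Z" ?G "top_of_set X" h ?g])
    show "closedin ?T (?I \<times> Z)" "\<And>j. j \<in> J \<Longrightarrow> closedin ?T (?G j)"
      using closed_Z closedin_cell by (auto intro!: closedin_Times)
    show "topspace ?T \<subseteq> ?I \<times> Z \<union> (\<Union>j\<in>J. ?G j)" using cover by auto
    have "subtopology ?T (?I \<times> Z) = top_of_set (?I \<times> Z)"
      using Z_subset by (simp add: subtopology_subtopology Int_absorb1 Sigma_mono)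
    then show "continuous_map (subtopology ?T (?I \<times> Z)) (top_of_set X) h"
      using h Z_subset by auto
    fix j assume j: "j \<in> J"
    have sub: "subtopology ?T (?G j) = top_of_set (?G j)"
      using e_in_X[OF j] by (simp add: subtopology_subtopology Int_absorb1 image_subset_iff Sigma_mono)
    have "continuous_on (?G j) (?g j)"
    proof (rule continuous_on_compose2[OF P_cont[OF j]])
      have "continuous_on (?G j) (\<lambda>p. chart j (snd p))"
        by (rule continuous_on_compose2[OF cont_chart[OF j]]) (use e_in_X[OF j] in \<open>auto intro: continuous_intros\<close>)
      then show "continuous_on (?G j) (\<lambda>p. (fst p, chart j (snd p)))"
        by (intro continuous_on_Pair continuous_on_fst continuous_on_id)
    qed (use chart_e[OF j] in auto)
    then show "continuous_map (subtopology ?T (?G j)) (top_of_set X) (?g j)"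
      unfolding sub using P_X[OF j] chart_e[OF j] by auto
    show "h x = ?g j x" if "x \<in> ?I \<times> Z" "x \<in> ?G j" for x
      using that P_Z[OF j] chart_e[OF j] by auto
    show "x \<in> ?I \<times> Z" if "i \<in> J" "j \<in> J" "i \<noteq> j" "x \<in> ?G i" "x \<in> ?G j" for i j x
      using that disjoint_interiors[of i j] by auto
  qed (use that in auto)
  show ?thesis
  proof (rule that[of H])
    show "continuous_map (prod_topology (top_of_set ?I) (top_of_set X)) (top_of_set X) H"
      using H(1) by simp
    show "H (t, z) = h (t, z)" if "t \<in> {0..1}" "z \<in> Z" for t z using H(2) that by simp
    show "H (0, x) = x" if "x \<in> X" for x
      using that H(2)[of "(0, x)"] H(3)[of _ "(0, x)"] h0 P_0 chart_e cover by auto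
  qed
qed

abbreviation "sphere_wedge \<equiv> wedge J (\<lambda>_. nsphere m) (\<lambda>_. pole)"

definition "sphere_class j x = (if x = pole then None else Some (j, x))"

lemma continuous_map_sphere_class:
  assumes "j \<in> J"
  shows "continuous_map (nsphere m) sphere_wedge (sphere_class j)"
  unfolding continuous_map_def
proof (intro conjI allI impI)
  show "sphere_class j \<in> topspace (nsphere m) \<rightarrow> topspace sphere_wedge"
    using assms by (auto simp: topspace_wedge sphere_class_def)
  fix U assume "openin sphere_wedge U"
  then have "openin (nsphere m) {x. (j, x) \<in> {x \<in> topspace (sum_topology (\<lambda>_. nsphere m) J).
      (\<lambda>(i, x). if x = pole then None else Some (i, x)) x \<in> U}}"
    using assms unfolding wedge_def openin_coinduced_topology openin_sum_topology by blast
  then show "openin (nsphere m) {x \<in> topspace (nsphere m). sphere_class j x \<in> U}"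
    by (rule back_subst[of "openin _"]) (use assms in \<open>auto simp: sphere_class_def\<close>)
qed

lemma openin_sphere_wedgeI:
  assumes "U \<subseteq> topspace sphere_wedge"
    "\<And>j. j \<in> J \<Longrightarrow> openin (nsphere m) {x \<in> topspace (nsphere m). sphere_class j x \<in> U}"
  shows "openin sphere_wedge U"
  unfolding wedge_def openin_coinduced_topology openin_sum_topology
proof (intro conjI ballI)
  fix j assume j: "j \<in> J"
  show "openin (nsphere m) {x. (j, x) \<in> {x \<in> topspace (sum_topology (\<lambda>_. nsphere m) J).
      (\<lambda>(i, x). if x = pole then None else Some (i, x)) x \<in> U}}"
    by (rule back_subst[of "openin _", OF assms(2)[OF j]]) (use j in \<open>auto simp: sphere_class_def\<close>)
qed (use assms(1) in \<open>auto simp: topspace_wedge\<close>)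

text \<open>The wedge is the quotient of \<open>X\<close> by \<open>Z\<close>.  A set in the wedge is open if its preimages in the
  spheres are, hence, as the simplices map onto the spheres by quotient maps, if its preimages
  in the simplices are.  In dimension \<open>0\<close> a simplex does not reach the pole, which is why
  \<open>0 < m\<close> is required as soon as something is attached.\<close>

lemma homotopy_equivalent_wedge_of_spheres:
  assumes "contractible Z" "Z \<noteq> {}" "J \<noteq> {} \<Longrightarrow> 0 < m"
  shows "top_of_set X homotopy_equivalent_space sphere_wedge"
proof -
  let ?D = "standard_simplex m" and ?I = "{0..1::real}"
  obtain a h where h: "continuous_on (?I \<times> Z) h" "\<And>t z. t \<in> ?I \<Longrightarrow> z \<in> Z \<Longrightarrow> h (t, z) \<in> Z"
    "\<And>z. h (0, z) = z" "\<And>z. h (1, z) = a"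
  proof -
    from assms(1) obtain a h where "continuous_on (?I \<times> Z) h \<and> h \<in> ?I \<times> Z \<rightarrow> Z"
      "\<forall>z. h (0, z) = z" "\<forall>z. h (1, z) = a"
      unfolding contractible_def homotopic_with_def by auto
    then show ?thesis by (intro that[of h a]) auto
  qed
  obtain H where H: "continuous_map (prod_topology (top_of_set ?I) (top_of_set X)) (top_of_set X) H"
    "\<And>x. x \<in> X \<Longrightarrow> H (0, x) = x" "\<And>t z. t \<in> ?I \<Longrightarrow> z \<in> Z \<Longrightarrow> H (t, z) = h (t, z)"
    using extend_contraction[OF h(1,2,3)] by blast
  let ?g = "\<lambda>j p. sphere_class j (simplex_to_sphere m (chart j p))"
  have gZ: "?g j (e j y) = None \<longleftrightarrow> e j y \<in> Z" if "j \<in> J" "y \<in> ?D" for j y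
    using that boundary chart_e simplex_to_sphere_eq_pole by (auto simp: sphere_class_def)
  obtain f where f: "continuous_map (top_of_set X) sphere_wedge f" "\<And>x. x \<in> Z \<Longrightarrow> f x = None"
    "\<And>j x. j \<in> J \<Longrightarrow> x \<in> e j ` ?D \<Longrightarrow> f x = ?g j x"
  proof (rule paste_over_cells[of "top_of_set X" Z "\<lambda>j. e j ` ?D" sphere_wedge "\<lambda>_. None" ?g])
    fix j assume j: "j \<in> J"
    have "subtopology (top_of_set X) (e j ` ?D) = top_of_set (e j ` ?D)"
      using e_in_X[OF j] by (simp add: subtopology_subtopology Int_absorb1 image_subset_iff)
    moreover have "continuous_map (top_of_set (e j ` ?D)) (nsphere m) (\<lambda>p. simplex_to_sphere m (chart j p))"
    proof -
      have "continuous_map (top_of_set (e j ` ?D)) (top_of_set ?D) (chart j)"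
        using continuous_on_subset[OF cont_chart[OF j], of "e j ` ?D"] e_in_X[OF j] chart_e[OF j] by auto
      from continuous_map_compose[OF this continuous_map_simplex_to_sphere] show ?thesis by (simp add: o_def)
    qed
    ultimately show "continuous_map (subtopology (top_of_set X) (e j ` ?D)) sphere_wedge (?g j)"
      using continuous_map_compose[OF _ continuous_map_sphere_class[OF j]] by (force simp: o_def)
    show "None = ?g j x" if "x \<in> Z" "x \<in> e j ` ?D" for x
      using that gZ[OF j] by force
    show "x \<in> Z" if "i \<in> J" "j \<in> J" "i \<noteq> j" "x \<in> e i ` ?D" "x \<in> e j ` ?D" for i j x
      using that disjoint_interiors by blast
  qed (use closed_Z closedin_cell cover that in \<open>auto simp: topspace_wedge\<close>)
  have fe: "f (e j y) = sphere_class j (simplex_to_sphere m y)" if "j \<in> J" "y \<in> ?D" for j y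
    using f(3)[of j "e j y"] chart_e that by simp
  have f_None: "f x = None \<longleftrightarrow> x \<in> Z" if "x \<in> X" for x
    using that f(2) f(3) gZ cover by auto
  have fib: "x = y \<or> x \<in> Z \<and> y \<in> Z" if xy: "x \<in> X" "y \<in> X" "f x = f y" for x y
  proof (cases "x \<in> Z \<or> y \<in> Z")
    case True
    then show ?thesis using xy f_None by metis
  next
    case False
    then obtain i j u v where *: "i \<in> J" "u \<in> ?D" "x = e i u" "j \<in> J" "v \<in> ?D" "y = e j v"
      using xy cover by blast
    then have "min_weight m u \<noteq> 0" "min_weight m v \<noteq> 0" using False boundary by auto
    moreover from this have "i = j" "simplex_to_sphere m u = simplex_to_sphere m v"
      using fe[of i u] fe[of j v] * xy(3) simplex_to_sphere_eq_pole[of u m] simplex_to_sphere_eq_pole[of v m]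
      by (auto simp: sphere_class_def split: if_splits)
    ultimately show ?thesis using * simplex_to_sphere_inj by metis
  qed
  have "quotient_map (top_of_set X) sphere_wedge f"
    unfolding quotient_map_def
  proof (intro conjI allI impI)
    have "w \<in> f ` X" if w: "w \<in> topspace sphere_wedge" for w
    proof (cases w)
      case None
      then show ?thesis using assms(2) Z_subset f(2) by (metis ex_in_conv image_eqI subsetD)
    next
      case (Some p)
      then obtain j x where p: "p = (j, x)" "j \<in> J" "x \<in> topspace (nsphere m)" "x \<noteq> pole"
        using w by (auto simp: topspace_wedge)
      then obtain y where "y \<in> ?D" "simplex_to_sphere m y = x" using simplex_to_sphere_surj by blast
      then have "f (e j y) = w" "e j y \<in> X" using fe e_in_X p Some by (auto simp: sphere_class_def)
      then show ?thesis by blast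
    qed
    then show "f ` topspace (top_of_set X) = topspace sphere_wedge"
      using continuous_map_image_subset_topspace[OF f(1)] by auto
    fix U assume U: "U \<subseteq> topspace sphere_wedge"
    show "openin (top_of_set X) {x \<in> topspace (top_of_set X). f x \<in> U} = openin sphere_wedge U"
    proof
      assume op: "openin (top_of_set X) {x \<in> topspace (top_of_set X). f x \<in> U}"
      show "openin sphere_wedge U"
      proof (rule openin_sphere_wedgeI[OF U])
        fix j assume j: "j \<in> J"
        let ?V = "{x \<in> topspace (nsphere m). sphere_class j x \<in> U}"
        have q: "quotient_map (top_of_set ?D) (nsphere m) (simplex_to_sphere m)"
          using j assms(3) quotient_map_simplex_to_sphere by blast
        have "continuous_map (top_of_set ?D) (top_of_set X) (e j)"
          using cont_e[OF j] e_in_X[OF j] by auto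
        from openin_continuous_map_preimage[OF this op]
        have "openin (top_of_set ?D) {y \<in> topspace (top_of_set ?D). simplex_to_sphere m y \<in> ?V}"
          by (rule back_subst[of "openin _"])
            (use fe[OF j] e_in_X[OF j] simplex_to_sphere_in_nsphere in auto)
        moreover have "?V \<subseteq> topspace (nsphere m)" by blast
        ultimately show "openin (nsphere m) ?V"
          using q unfolding quotient_map_def by blast
      qed
    qed (use openin_continuous_map_preimage[OF f(1)] in blast)
  qed
  then show ?thesis
  proof (rule homotopy_equivalent_quotient_of_contracted_subset[where Z = Z and H = H])
  qed (use H h(2,4) fib f(2) Z_subset in auto)
qed

end

section \<open>Simplices of a word space\<close>

text \<open>Conversion from barycentric coordinates indexed by positions to weights of letters.\<close>

definition word_weights :: "'a list \<Rightarrow> (nat \<Rightarrow> real) \<Rightarrow> 'a \<Rightarrow> real" where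
  "word_weights w y = (\<lambda>c. \<Sum>k<length w. if w ! k = c then y k else 0)"

definition simplex_point :: "'a list \<Rightarrow> (nat \<Rightarrow> real) \<Rightarrow> 'a list \<Rightarrow> real" where
  "simplex_point w y = word_point w (word_weights w y)"

definition simplex_chart :: "'a list \<Rightarrow> ('a list \<Rightarrow> real) \<Rightarrow> nat \<Rightarrow> real" where
  "simplex_chart w p = (\<lambda>k. if k < length w then p [w ! k] else 0)"

lemma word_weights_nth:
  assumes "distinct w" "k < length w"
  shows "word_weights w y (w ! k) = y k"
proof -
  have "word_weights w y (w ! k) = (\<Sum>i<length w. if i = k then y i else 0)"
    unfolding word_weights_def using assms by (intro sum.cong) (auto simp: nth_eq_iff_index_eq)
  then show ?thesis using assms by simp
qed

lemma word_weights_outside: "c \<notin> set w \<Longrightarrow> word_weights w y c = 0"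
  by (auto simp: word_weights_def intro!: sum.neutral)

lemma word_weights_in_weights:
  assumes "distinct w" "length w = Suc n" "y \<in> standard_simplex n"
  shows "word_weights w y \<in> weights w"
proof -
  have "sum (word_weights w y) (set w) = (\<Sum>k<length w. word_weights w y (w ! k))"
    by (rule sum.reindex_bij_betw[symmetric]) (use assms in \<open>auto intro!: bij_betw_nth\<close>)
  also have "\<dots> = (\<Sum>k\<le>n. y k)"
    using assms by (intro sum.cong) (auto simp: word_weights_nth)
  also have "\<dots> = 1" using assms by (simp add: standard_simplex_def)
  finally have "sum (word_weights w y) (set w) = 1" .
  moreover have "0 \<le> word_weights w y c" for c
    unfolding word_weights_def using assms(3) by (intro sum_nonneg) (auto simp: standard_simplex_def)
  ultimately show ?thesis
    using word_weights_outside by (auto simp: weights_def)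
qed

lemma simplex_chart_point:
  assumes "distinct w" "length w = Suc n" "y \<in> standard_simplex n"
  shows "simplex_chart w (simplex_point w y) = y"
proof
  fix k
  have "simplex_point w y [c] = word_weights w y c" for c
    using letter_weights_word_point[OF word_weights_in_weights[OF assms]]
    by (metis letter_weights_def simplex_point_def)
  then show "simplex_chart w (simplex_point w y) k = y k"
    using assms word_weights_nth[OF assms(1), of k y]
    by (auto simp: simplex_chart_def standard_simplex_def)
qed

lemma image_simplex_point:
  assumes "distinct w" "length w = Suc n"
  shows "simplex_point w ` standard_simplex n = cell w"
proof -
  have "a \<in> word_weights w ` standard_simplex n" if a: "a \<in> weights w" for a
  proof
    let ?y = "\<lambda>k. if k \<le> n then a (w ! k) else 0"
    have "sum a (set w) = (\<Sum>k<length w. a (w ! k))"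
      by (rule sum.reindex_bij_betw[symmetric]) (use assms in \<open>auto intro!: bij_betw_nth\<close>)
    then have "(\<Sum>k\<le>n. ?y k) = 1"
      using a assms by (simp add: weights_def lessThan_Suc_atMost)
    then show "?y \<in> standard_simplex n"
      using a by (intro standard_simplexI) (auto simp: weights_def)
    show "a = word_weights w ?y"
    proof
      fix c
      show "a c = word_weights w ?y c"
      proof (cases "c \<in> set w")
        case True
        then obtain k where "k < length w" "c = w ! k" by (metis in_set_conv_nth)
        then show ?thesis using word_weights_nth[OF assms(1)] assms(2) by simp
      next
        case False
        then show ?thesis using a word_weights_outside[OF False] by (simp add: weights_def)
      qed
    qed
  qed
  then have "word_weights w ` standard_simplex n = weights w"
    using word_weights_in_weights[OF assms] by blast
  then show ?thesis unfolding cell_def simplex_point_def by (metis image_image)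
qed

lemma continuous_on_simplex_point: "continuous_on S (simplex_point w)"
proof -
  have "continuous_on S (word_weights w)"
    unfolding word_weights_def
  proof (intro continuous_on_coordinatewise_then_product continuous_on_sum)
    show "continuous_on S (\<lambda>y. if w ! k = c then y k else 0)" for c k
      by (cases "w ! k = c") (auto intro: continuous_on_coordinate)
  qed
  then show ?thesis
    unfolding simplex_point_def by (rule continuous_on_compose2[OF continuous_on_word_point[of UNIV]]) auto
qed

lemma continuous_on_simplex_chart: "continuous_on S (simplex_chart w)"
  unfolding simplex_chart_def
proof (rule continuous_on_coordinatewise_then_product)
  show "continuous_on S (\<lambda>p. if k < length w then p [w ! k] else 0)" for k
    by (cases "k < length w") (auto intro: continuous_on_coordinate)
qed

lemma simplex_point_support:
  assumes "distinct w" "length w = Suc n" "y \<in> standard_simplex n" "\<And>k. k \<le> n \<Longrightarrow> y k \<noteq> 0"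
  shows "simplex_point w y v \<noteq> 0 \<longleftrightarrow> subseq v w"
proof -
  have "word_weights w y c \<noteq> 0" if "c \<in> set v" "subseq v w" for c
  proof -
    have "c \<in> set w" using that subseq_imp_subset by blast
    then obtain k where "k < length w" "c = w ! k" by (metis in_set_conv_nth)
    then show ?thesis using word_weights_nth[OF assms(1)] assms(2,4) by simp
  qed
  then show ?thesis by (auto simp: simplex_point_def word_point_def)
qed

lemma simplex_point_face:
  assumes "distinct x" "length x = Suc (Suc n)" "i \<le> Suc n"
  shows "simplex_point (take i x @ drop (Suc i) x) y = simplex_point x (simplical_face i y)"
proof -
  let ?v = "take i x @ drop (Suc i) x" and ?a = "word_weights x (simplical_face i y)"
  have x: "x = take i x @ x ! i # drop (Suc i) x" using assms by (intro id_take_nth_drop) simp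
  then have d: "distinct (take i x @ x ! i # drop (Suc i) x)" and s: "set x = insert (x ! i) (set ?v)"
    using assms(1) by (metis, metis Un_insert_right list.simps(15) set_append)
  then have dv: "distinct ?v" by simp
  have sub: "subseq ?v x" by (subst (3) x) (auto intro: list_emb_append_mono)
  have out: "?a c = 0" if "c \<notin> set ?v" for c
  proof (cases "c = x ! i")
    case True
    then show ?thesis using word_weights_nth[OF assms(1), of i] assms by (simp add: simplical_face_def)
  next
    case False
    then show ?thesis using that s by (intro word_weights_outside) auto
  qed
  have "word_weights ?v y = ?a"
  proof
    fix c
    show "word_weights ?v y c = ?a c"
    proof (cases "c \<in> set ?v")
      case True
      then obtain k where k: "k < length ?v" "c = ?v ! k" by (metis in_set_conv_nth)
      have "c = x ! (if k < i then k else Suc k)" using k assms by (auto simp: nth_append)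
      then have "?a c = simplical_face i y (if k < i then k else Suc k)"
        using k assms word_weights_nth[OF assms(1)] by simp
      also have "\<dots> = y k" by (simp add: simplical_face_def)
      finally show ?thesis using word_weights_nth[OF dv k(1)] k(2) by simp
    next
      case False
      then show ?thesis using out word_weights_outside by metis
    qed
  qed
  then show ?thesis
    unfolding simplex_point_def using word_point_subword[OF assms(1) sub out] by simp
qed

text \<open>The simplices of the unmatched words are attached to the space of the matched words.  A point
  of such a simplex lies in that space only if it is on the boundary: otherwise the unmatched
  word would be a subword of a matched one, hence equal to it, as it already uses every letter.\<close>

lemma word_space_all_words_wedge:
  assumes C: "finite C" "C \<noteq> {}"
  shows "\<exists>J::nat set. top_of_set (word_space (all_words C)) homotopy_equivalent_space
    wedge J (\<lambda>_. nsphere (card C - 1)) (\<lambda>_. pole)"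
proof -
  let ?Z = "word_space (matched_words C)" and ?X = "word_space (all_words C)"
  define m where "m = card C - 1"
  have m: "card C = Suc m" using C by (simp add: m_def card_gt_0_iff)
  have "finite (all_words C - matched_words C)" using finite_all_words C by blast
  then obtain ws where ws: "set ws = all_words C - matched_words C" "distinct ws"
    using finite_distinct_list by blast
  have W: "ws ! j \<in> all_words C" "ws ! j \<notin> matched_words C" "set (ws ! j) = C"
    "distinct (ws ! j)" "length (ws ! j) = Suc m" if "j < length ws" for j
  proof -
    show a: "ws ! j \<in> all_words C" "ws ! j \<notin> matched_words C" using nth_mem[OF that] ws by auto
    then show b: "set (ws ! j) = C" using unmatched_full C by blast
    show c: "distinct (ws ! j)" using a by (simp add: all_words_def)
    show "length (ws ! j) = Suc m" using distinct_card[OF c] b m by simp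
  qed
  have bd: "simplex_point (ws ! j) y \<in> ?Z \<longleftrightarrow> min_weight m y = 0"
    if j: "j < length ws" and y: "y \<in> standard_simplex m" for j y
  proof
    assume "min_weight m y = 0"
    then obtain k where k: "k \<le> m" "y k = 0" using min_weight_attained[of m y] by auto
    let ?w = "ws ! j" and ?v = "filter (\<lambda>c. c \<noteq> ws ! j ! k) (ws ! j)" and ?a = "word_weights (ws ! j) y"
    have a: "?a \<in> weights ?w" using word_weights_in_weights W(4,5)[OF j] y by blast
    have "?a (?w ! k) = 0" using word_weights_nth[OF W(4)[OF j]] W(5)[OF j] k by simp
    then have out: "?a c = 0" if "c \<notin> set ?v" for c
      using that word_weights_outside[of c ?w y] by (cases "c = ?w ! k") auto
    have v: "subseq ?v ?w" by simp
    have "word_point ?w ?a = word_point ?v ?a"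
      using out by (rule word_point_subword[OF W(4)[OF j] v])
    moreover have "?a \<in> weights ?v"
      using out by (rule weights_subword[OF a subseq_imp_subset[OF v]])
    ultimately have "simplex_point ?w y \<in> cell ?v"
      by (simp add: simplex_point_def cell_def)
    moreover have "?w ! k \<in> set ?w" "?w ! k \<notin> set ?v" using k W(5)[OF j] by auto
    then have "?v \<noteq> ?w" by metis
    then have "?v \<in> matched_words C" using proper_subword_matched[OF C(1) W(1)[OF j] v] by blast
    ultimately show "simplex_point ?w y \<in> ?Z" by (auto simp: word_space_def)
  next
    assume Z: "simplex_point (ws ! j) y \<in> ?Z"
    show "min_weight m y = 0"
    proof (rule ccontr)
      assume "min_weight m y \<noteq> 0"
      then have "y k \<noteq> 0" if "k \<le> m" for k
        using min_weight_le[OF that, of y] min_weight_bounds(1)[OF y] by auto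
      then have "simplex_point (ws ! j) y (ws ! j) \<noteq> 0"
        using simplex_point_support[OF W(4,5)[OF j] y] by simp
      then obtain w where w: "w \<in> matched_words C" "subseq (ws ! j) w"
        using word_space_support[OF Z] by blast
      then have "ws ! j = w"
        using proper_subword_matched[OF C(1) _ w(2)] matched_words_subset W(2)[OF j] by blast
      then show False using w(1) W(2)[OF j] by simp
    qed
  qed
  have sub: "cell w \<subseteq> ?X" if "w \<in> all_words C" for w using that by (auto simp: word_space_def)
  interpret attached_simplices ?X ?Z "{..<length ws}" m "\<lambda>j. simplex_point (ws ! j)" "\<lambda>j. simplex_chart (ws ! j)"
  proof
    show "?Z \<subseteq> ?X" using word_space_mono[OF matched_words_subset] .
    then show "closedin (top_of_set ?X) ?Z"
      using word_complex_matched_words[OF C(1)] by (auto simp: word_complex_def intro!: closed_subset closed_word_space)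
    show "closedin (top_of_set ?X) (simplex_point (ws ! j) ` standard_simplex m)" if "j \<in> {..<length ws}" for j
      using that W[of j] sub[of "ws ! j"] by (auto simp: image_simplex_point intro!: closed_subset closed_cell)
    have "?X = ?Z \<union> (\<Union>w\<in>set ws. cell w)"
      using matched_words_subset[of C] unfolding ws(1) by (auto simp: word_space_def)
    also have "(\<Union>w\<in>set ws. cell w) = (\<Union>j<length ws. cell (ws ! j))"
      by (auto simp: set_conv_nth)
    also have "\<dots> = (\<Union>j<length ws. simplex_point (ws ! j) ` standard_simplex m)"
      by (rule SUP_cong[OF refl], rule image_simplex_point[OF W(4,5), symmetric]) auto
    finally show "?X = ?Z \<union> (\<Union>j<length ws. simplex_point (ws ! j) ` standard_simplex m)" .
    show "simplex_point (ws ! i) y \<in> ?Z"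
      if "i \<in> {..<length ws}" "j \<in> {..<length ws}" "y \<in> standard_simplex m" "z \<in> standard_simplex m"
        "simplex_point (ws ! i) y = simplex_point (ws ! j) z" "i \<noteq> j" for i j y z
    proof (rule ccontr)
      have ij: "i < length ws" "j < length ws" using that by auto
      assume "simplex_point (ws ! i) y \<notin> ?Z"
      then have "min_weight m y \<noteq> 0" using bd[OF ij(1) that(3)] by simp
      then have "y k \<noteq> 0" if "k \<le> m" for k
        using min_weight_le[OF that, of y] min_weight_bounds(1)[OF \<open>y \<in> _\<close>] by auto
      then have "simplex_point (ws ! i) y (ws ! i) \<noteq> 0"
        using simplex_point_support[OF W(4,5)[OF ij(1)] that(3)] by simp
      then have "subseq (ws ! i) (ws ! j)"
        unfolding that(5) by (auto simp: simplex_point_def word_point_def split: if_splits)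
      then have "ws ! i = ws ! j"
        using subseq_same_length W(5)[OF ij(1)] W(5)[OF ij(2)] by metis
      then show False using ws(2) ij that(6) by (simp add: nth_eq_iff_index_eq)
    qed
    show "simplex_chart (ws ! j) (simplex_point (ws ! j) y) = y"
      if "j \<in> {..<length ws}" "y \<in> standard_simplex m" for j y
      using that by (intro simplex_chart_point[OF W(4,5)]) auto
  qed (use bd in \<open>auto simp: continuous_on_simplex_point continuous_on_simplex_chart\<close>)
  \<comment> \<open>over a one-letter alphabet the only nonempty word is matched with the empty word\<close>
  have "0 < m" if "{..<length ws} \<noteq> {}"
  proof (rule ccontr)
    assume "\<not> 0 < m"
    have "0 < length ws" using that by (cases ws) auto
    with \<open>\<not> 0 < m\<close> have len: "length (ws ! 0) = 1" "0 < length ws" using W(5)[of 0] by auto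
    then obtain c where "ws ! 0 = [c]" by (auto simp: length_Suc_conv)
    then have "C = {c}" "ws ! 0 = [c]" using W(3)[of 0] len by auto
    then have "pivot C = c" using pivot_in[of C] by simp
    then have "matched C (squash (length ([]::'a list))) [] (ws ! 0)"
      unfolding \<open>ws ! 0 = [c]\<close> using C by (intro matched.front) auto
    then show False using W(2)[of 0] len by (auto simp: matched_words_def)
  qed
  then have "top_of_set ?X homotopy_equivalent_space sphere_wedge"
    using homotopy_equivalent_wedge_of_spheres contractible_matched_words[OF C] by blast
  then show ?thesis unfolding m_def by blast
qed

section \<open>The realisation as a word space\<close>

lemma homeomorphic_space_of_same_fibres:
  assumes f: "quotient_map X Y f" and g: "quotient_map X Z g"
    and fib: "\<And>x y. \<lbrakk>x \<in> topspace X; y \<in> topspace X\<rbrakk> \<Longrightarrow> f x = f y \<longleftrightarrow> g x = g y"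
  shows "Y homeomorphic_space Z"
proof -
  obtain u where u: "continuous_map Y Z u" "\<And>x. x \<in> topspace X \<Longrightarrow> u (f x) = g x"
    using quotient_map_lift_exists[OF f quotient_imp_continuous_map[OF g]] fib by metis
  obtain v where v: "continuous_map Z Y v" "\<And>x. x \<in> topspace X \<Longrightarrow> v (g x) = f x"
    using quotient_map_lift_exists[OF g quotient_imp_continuous_map[OF f]] fib by metis
  have "homeomorphic_maps Y Z u v"
    unfolding homeomorphic_maps_def
  proof (intro conjI ballI)
    show "v (u y) = y" if "y \<in> topspace Y" for y
      using that u(2) v(2) quotient_imp_surjective_map[OF f] by (metis imageE)
    show "u (v z) = z" if "z \<in> topspace Z" for z
      using that u(2) v(2) quotient_imp_surjective_map[OF g] by (metis imageE)
  qed (use u v in auto)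
  then show ?thesis using homeomorphic_maps_imp_homeomorphic_space by blast
qed

definition realisation_map :: "nat \<times> 'a list \<times> (nat \<Rightarrow> real) \<Rightarrow> 'a list \<Rightarrow> real" where
  "realisation_map = (\<lambda>(n, w, y). simplex_point w y)"

abbreviation injective_word_cells where
  "injective_word_cells C \<equiv> simplex_coproduct (injective_words C)"

lemma simplices_injective_words:
  "w \<in> simplices (injective_words C) n \<longleftrightarrow> w \<in> all_words C \<and> length w = Suc n"
  by (auto simp: injective_words_def all_words_def)

lemma topspace_injective_word_cells:
  "(n, w, y) \<in> topspace (injective_word_cells C) \<longleftrightarrow>
     w \<in> all_words C \<and> length w = Suc n \<and> y \<in> standard_simplex n"
  by (auto simp: topspace_simplex_coproduct simplices_injective_words)

lemma openin_simplex_coproduct: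
  "openin (simplex_coproduct X) U \<longleftrightarrow>
     U \<subseteq> topspace (simplex_coproduct X) \<and>
     (\<forall>n. \<forall>x\<in>simplices X n. openin (top_of_set (standard_simplex n)) {y. (n, x, y) \<in> U})"
  (is "_ \<longleftrightarrow> _ \<and> ?R")
proof -
  have e: "subtopology (powertop_real UNIV) S = top_of_set S" for S :: "(nat \<Rightarrow> real) set"
    by (simp add: euclidean_product_topology)
  have "(\<forall>n. openin (prod_topology (discrete_topology (simplices X n)) (top_of_set (standard_simplex n)))
            {p. (n, p) \<in> U}) \<longleftrightarrow> ?R" if U: "U \<subseteq> topspace (simplex_coproduct X)"
  proof (intro iff_allI)
    fix n
    let ?P = "prod_topology (discrete_topology (simplices X n)) (top_of_set (standard_simplex n))"
    show "openin ?P {p. (n, p) \<in> U} \<longleftrightarrow>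
      (\<forall>x\<in>simplices X n. openin (top_of_set (standard_simplex n)) {y. (n, x, y) \<in> U})"
    proof
      assume o: "openin ?P {p. (n, p) \<in> U}"
      show "\<forall>x\<in>simplices X n. openin (top_of_set (standard_simplex n)) {y. (n, x, y) \<in> U}"
      proof
        fix x assume x: "x \<in> simplices X n"
        have "continuous_map (top_of_set (standard_simplex n)) ?P (\<lambda>y. (x, y))"
          using x by (simp add: continuous_map_pairwise o_def)
        from openin_continuous_map_preimage[OF this o]
        show "openin (top_of_set (standard_simplex n)) {y. (n, x, y) \<in> U}"
          by (rule back_subst[of "openin _"]) (use U in \<open>auto simp: topspace_simplex_coproduct\<close>)
      qed
    next
      assume R: "\<forall>x\<in>simplices X n. openin (top_of_set (standard_simplex n)) {y. (n, x, y) \<in> U}"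
      have "openin ?P (\<Union>x\<in>simplices X n. {x} \<times> {y. (n, x, y) \<in> U})"
        using R by (intro openin_Union) (auto simp: openin_prod_Times_iff)
      moreover have "(\<Union>x\<in>simplices X n. {x} \<times> {y. (n, x, y) \<in> U}) = {p. (n, p) \<in> U}"
        using U by (auto simp: topspace_simplex_coproduct)
      ultimately show "openin ?P {p. (n, p) \<in> U}" by simp
    qed
  qed
  then show ?thesis
    using openin_subset[of "simplex_coproduct X" U]
    unfolding simplex_coproduct_def openin_sum_topology e topspace_sum_topology by auto
qed

lemma closedin_simplex_coproduct_slice:
  assumes "closedin (simplex_coproduct X) F" "x \<in> simplices X n"
  shows "closedin (top_of_set (standard_simplex n)) {y. (n, x, y) \<in> F}"
proof -
  have F: "F \<subseteq> topspace (simplex_coproduct X)" "openin (simplex_coproduct X) (topspace (simplex_coproduct X) - F)"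
    using assms(1) by (auto simp: closedin_def)
  then have "openin (top_of_set (standard_simplex n)) {y. (n, x, y) \<in> topspace (simplex_coproduct X) - F}"
    using assms(2) unfolding openin_simplex_coproduct by blast
  moreover have "{y. (n, x, y) \<in> topspace (simplex_coproduct X) - F} = standard_simplex n - {y. (n, x, y) \<in> F}"
    using assms(2) by (auto simp: topspace_simplex_coproduct)
  moreover have "{y. (n, x, y) \<in> F} \<subseteq> standard_simplex n"
    using F(1) by (auto simp: topspace_simplex_coproduct)
  ultimately show ?thesis by (simp add: closedin_def)
qed

lemma realisation_map_in: "p \<in> topspace (injective_word_cells C) \<Longrightarrow> realisation_map p \<in> word_space (all_words C)"
proof -
  assume p: "p \<in> topspace (injective_word_cells C)"
  obtain n w y where nwy: "p = (n, w, y)" by (cases p)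
  then have w: "w \<in> all_words C" "length w = Suc n" "y \<in> standard_simplex n"
    using p topspace_injective_word_cells by auto
  then have "simplex_point w y \<in> cell w" using image_simplex_point[of w n] by (auto simp: all_words_def)
  then show ?thesis using w(1) nwy by (auto simp: realisation_map_def word_space_def)
qed

text \<open>On each of the finitely many closed cells, the chart is a continuous
  inverse of the parametrisation, so a set whose preimage is closed meets each cell in a closed
  set.\<close>

lemma quotient_map_realisation_map:
  assumes "finite C"
  shows "quotient_map (injective_word_cells C) (top_of_set (word_space (all_words C))) realisation_map"
  unfolding quotient_map_closedin
proof (intro conjI allI impI iffI)
  let ?X = "word_space (all_words C)" and ?D = "injective_word_cells C"
  have cell: "\<exists>y\<in>standard_simplex (length w - 1). simplex_point w y = p"
    if "w \<noteq> []" "w \<in> all_words C" "p \<in> cell w" for w p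
  proof -
    have "p \<in> simplex_point w ` standard_simplex (length w - 1)"
      using image_simplex_point[of w "length w - 1"] that by (simp add: all_words_def)
    then show ?thesis by blast
  qed
  have "p \<in> realisation_map ` topspace ?D" if p: "p \<in> ?X" for p
  proof -
    obtain w where w: "w \<in> all_words C" "p \<in> cell w" using p by (auto simp: word_space_def)
    then have "w \<noteq> []" by (auto simp: cell_def)
    then obtain y where "y \<in> standard_simplex (length w - 1)" "simplex_point w y = p" using cell w by blast
    then show ?thesis
      using w \<open>w \<noteq> []\<close>
      by (intro image_eqI[of _ _ "(length w - 1, w, y)"])
        (auto simp: realisation_map_def topspace_injective_word_cells)
  qed
  then show "realisation_map ` topspace ?D = topspace (top_of_set ?X)"
    using realisation_map_in by auto
  have cont: "continuous_map ?D (top_of_set ?X) realisation_map"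
    unfolding continuous_map_def
  proof (intro conjI allI impI)
    show "realisation_map \<in> topspace ?D \<rightarrow> topspace (top_of_set ?X)" using realisation_map_in by auto
    fix U assume "openin (top_of_set ?X) U"
    then obtain V where V: "open V" "U = ?X \<inter> V" by (auto simp: openin_open)
    show "openin ?D {p \<in> topspace ?D. realisation_map p \<in> U}"
      unfolding openin_simplex_coproduct
    proof (intro conjI allI ballI)
      fix n w assume w: "w \<in> simplices (injective_words C) n"
      have "openin (top_of_set (standard_simplex n)) (standard_simplex n \<inter> simplex_point w -` V)"
        using continuous_on_simplex_point V(1) by (rule continuous_openin_preimage_gen)
      then show "openin (top_of_set (standard_simplex n)) {y. (n, w, y) \<in> {p \<in> topspace ?D. realisation_map p \<in> U}}"
        by (rule back_subst[of "openin _"])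
          (use w realisation_map_in[of "(n, w, _)" C] V(2) in
            \<open>auto simp: realisation_map_def topspace_injective_word_cells simplices_injective_words\<close>)
    qed auto
  qed
  fix F assume F: "F \<subseteq> topspace (top_of_set ?X)"
  show "closedin ?D {p \<in> topspace ?D. realisation_map p \<in> F}" if "closedin (top_of_set ?X) F"
    using cont that by (rule closedin_continuous_map_preimage)
  assume cl: "closedin ?D {p \<in> topspace ?D. realisation_map p \<in> F}"
  have "closedin (top_of_set ?X) (F \<inter> cell w)" if w: "w \<in> all_words C" for w
  proof (cases "w = []")
    case True
    then show ?thesis by (simp add: cell_def)
  next
    case False
    then obtain n where n: "length w = Suc n" by (cases w) auto
    let ?S = "standard_simplex n"
    have d: "distinct w" using w by (simp add: all_words_def)
    have "closedin (top_of_set ?S) {y. (n, w, y) \<in> {p \<in> topspace ?D. realisation_map p \<in> F}}"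
      using cl w n by (intro closedin_simplex_coproduct_slice) (auto simp: simplices_injective_words)
    then have "closedin (top_of_set ?S) {y \<in> ?S. simplex_point w y \<in> F}"
      by (rule back_subst[of "closedin _"])
        (use w n in \<open>auto simp: realisation_map_def topspace_injective_word_cells\<close>)
    then obtain T where T: "closed T" "{y \<in> ?S. simplex_point w y \<in> F} = ?S \<inter> T"
      by (auto simp: closedin_closed)
    have "F \<inter> cell w = cell w \<inter> simplex_chart w -` T"
    proof (rule Set.set_eqI)
      fix p
      show "p \<in> F \<inter> cell w \<longleftrightarrow> p \<in> cell w \<inter> simplex_chart w -` T"
      proof (cases "p \<in> cell w")
        case True
        then obtain y where y: "y \<in> ?S" "p = simplex_point w y"
          using image_simplex_point[OF d n] by blast
        then show ?thesis using True T(2) simplex_chart_point[OF d n y(1)] by auto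
      qed auto
    qed
    moreover have "closed (cell w \<inter> simplex_chart w -` T)"
      by (intro closed_Int closed_cell closed_vimage T(1) continuous_on_simplex_chart)
    ultimately show ?thesis
      using F by (auto intro: closed_subset)
  qed
  then have "closedin (top_of_set ?X) (\<Union>w\<in>all_words C. F \<inter> cell w)"
    using finite_all_words[OF assms] by (intro closedin_Union) auto
  moreover have "(\<Union>w\<in>all_words C. F \<inter> cell w) = F" using F by (auto simp: word_space_def)
  ultimately show "closedin (top_of_set ?X) F" by simp
qed

lemma equiv_glue_equiv: "sym (glue_equiv X)" "trans (glue_equiv X)" "refl (glue_equiv X)"
  unfolding glue_equiv_def
  by (auto intro!: sym_rtrancl trans_rtrancl refl_rtrancl simp: sym_Un_converse)

lemma glue_equiv_class_eq: "glue_equiv X `` {p} = glue_equiv X `` {q} \<longleftrightarrow> (p, q) \<in> glue_equiv X"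
  using equiv_glue_equiv[of X] by (auto dest: symD transD reflD)

lemma realisation_map_glue:
  assumes "(p, q) \<in> glue (injective_words C)"
  shows "realisation_map p = realisation_map q"
proof -
  obtain n i x y where *: "p = (n, face (injective_words C) n i x, y)" "q = (Suc n, x, simplical_face i y)"
    "i \<le> Suc n" "x \<in> simplices (injective_words C) (Suc n)"
    using assms by (auto simp: glue_def)
  then show ?thesis
    using simplex_point_face[of x n i y] face_injective_words[OF *(3,4)]
    by (auto simp: realisation_map_def simplices_injective_words all_words_def)
qed

lemma realisation_map_glue_equiv:
  assumes "(p, q) \<in> glue_equiv (injective_words C)"
  shows "realisation_map p = realisation_map q"
  using assms unfolding glue_equiv_def
  by (induction rule: rtrancl_induct) (auto dest: realisation_map_glue)

lemma standard_simplex_face_preimage: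
  assumes "y \<in> standard_simplex (Suc n)" "k \<le> Suc n" "y k = 0"
  shows "\<exists>z\<in>standard_simplex n. y = simplical_face k z"
proof
  let ?z = "\<lambda>i. y (if i < k then i else Suc i)"
  have "bij_betw (\<lambda>i. if i < k then i else Suc i) {..n} ({..Suc n} - {k})"
    by (rule bij_betw_byWitness[where f' = "\<lambda>i. if i < k then i else i - 1"]) (use assms(2) in auto)
  then have "(\<Sum>i\<le>n. ?z i) = (\<Sum>i\<in>{..Suc n} - {k}. y i)"
    by (rule sum.reindex_bij_betw)
  also have "\<dots> = (\<Sum>i\<le>Suc n. y i)"
    using assms by (intro sum.mono_neutral_left) auto
  finally have "(\<Sum>i\<le>n. ?z i) = 1" using assms(1) by (simp add: standard_simplex_def)
  then show "?z \<in> standard_simplex n"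
    using assms by (intro standard_simplexI) (auto simp: standard_simplex_def)
  show "y = simplical_face k ?z"
    using assms(3) by (auto simp: simplical_face_def fun_eq_iff)
qed

text \<open>Removing the coordinates that vanish one at a time leads to an equivalent point in the interior
  of a simplex.\<close>

lemma glue_equiv_reduced:
  assumes "(n, w, y) \<in> topspace (injective_word_cells C)"
  shows "\<exists>n' w' y'. (n', w', y') \<in> topspace (injective_word_cells C) \<and>
    ((n', w', y'), (n, w, y)) \<in> glue_equiv (injective_words C) \<and> (\<forall>k\<le>n'. y' k \<noteq> 0)"
  using assms
proof (induction n arbitrary: w y)
  case 0
  then have "y 0 \<noteq> 0" by (auto simp: topspace_injective_word_cells standard_simplex_def)
  then show ?case using 0 equiv_glue_equiv(3) by (metis le_zero_eq refl_onD UNIV_I)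
next
  case (Suc n)
  show ?case
  proof (cases "\<forall>k\<le>Suc n. y k \<noteq> 0")
    case True
    then show ?thesis using Suc.prems equiv_glue_equiv(3) by (metis refl_onD UNIV_I)
  next
    case False
    then obtain k where k: "k \<le> Suc n" "y k = 0" by blast
    have w: "w \<in> simplices (injective_words C) (Suc n)" "y \<in> standard_simplex (Suc n)"
      using Suc.prems by (auto simp: topspace_simplex_coproduct)
    obtain z where z: "z \<in> standard_simplex n" "y = simplical_face k z"
      using standard_simplex_face_preimage[OF w(2) k] by blast
    let ?f = "face (injective_words C) n k w"
    have g: "((n, ?f, z), (Suc n, w, y)) \<in> glue (injective_words C)"
      using k w z by (auto simp: glue_def)
    then have "(n, ?f, z) \<in> topspace (injective_word_cells C)"
      using glue_subset[OF semi_simplicial_injective_words] by blast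
    from Suc.IH[OF this] obtain n' w' y' where
      *: "(n', w', y') \<in> topspace (injective_word_cells C)"
      "((n', w', y'), (n, ?f, z)) \<in> glue_equiv (injective_words C)" "\<forall>k\<le>n'. y' k \<noteq> 0" by blast
    moreover have "((n, ?f, z), (Suc n, w, y)) \<in> glue_equiv (injective_words C)"
      using g unfolding glue_equiv_def by blast
    ultimately show ?thesis using equiv_glue_equiv(2) by (meson transD)
  qed
qed

text \<open>An interior point is nonzero precisely on the subwords of its word.\<close>

lemma reduced_eq:
  assumes "(n, w, y) \<in> topspace (injective_word_cells C)" "\<forall>k\<le>n. y k \<noteq> 0"
    and "(n', w', y') \<in> topspace (injective_word_cells C)" "\<forall>k\<le>n'. y' k \<noteq> 0"
    and eq: "simplex_point w y = simplex_point w' y'"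
  shows "(n, w, y) = (n', w', y')"
proof -
  have 1: "distinct w" "length w = Suc n" "y \<in> standard_simplex n"
    and 2: "distinct w'" "length w' = Suc n'" "y' \<in> standard_simplex n'"
    using assms by (auto simp: topspace_injective_word_cells all_words_def)
  have "subseq v w \<longleftrightarrow> subseq v w'" for v
    using simplex_point_support[OF 1, of v] simplex_point_support[OF 2, of v] assms(2,4) eq by auto
  then have "w = w'" by (meson subseq_order.antisym subseq_order.order_refl)
  moreover from this have "y = y'"
    using simplex_chart_point[OF 1] simplex_chart_point[OF 2] eq by metis
  ultimately show ?thesis using 1(2) 2(2) by simp
qed

lemma realisation_map_eq_iff:
  assumes "p \<in> topspace (injective_word_cells C)" "q \<in> topspace (injective_word_cells C)"
  shows "(p, q) \<in> glue_equiv (injective_words C) \<longleftrightarrow> realisation_map p = realisation_map q"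
proof
  show "(p, q) \<in> glue_equiv (injective_words C) \<Longrightarrow> realisation_map p = realisation_map q"
    by (rule realisation_map_glue_equiv)
  assume eq: "realisation_map p = realisation_map q"
  have "\<exists>n w y. (n, w, y) \<in> topspace (injective_word_cells C) \<and>
      ((n, w, y), x) \<in> glue_equiv (injective_words C) \<and> (\<forall>k\<le>n. y k \<noteq> 0)"
    if "x \<in> topspace (injective_word_cells C)" for x
    using glue_equiv_reduced that by (cases x) auto
  from this[OF assms(1)] this[OF assms(2)] obtain n w y n' w' y' where
    p: "(n, w, y) \<in> topspace (injective_word_cells C)" "((n, w, y), p) \<in> glue_equiv (injective_words C)"
      "\<forall>k\<le>n. y k \<noteq> 0" and
    q: "(n', w', y') \<in> topspace (injective_word_cells C)" "((n', w', y'), q) \<in> glue_equiv (injective_words C)"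
      "\<forall>k\<le>n'. y' k \<noteq> 0"
    by blast
  have "simplex_point w y = simplex_point w' y'"
    using realisation_map_glue_equiv[OF p(2)] realisation_map_glue_equiv[OF q(2)] eq
    by (simp add: realisation_map_def)
  then have "(n, w, y) = (n', w', y')" by (rule reduced_eq[OF p(1,3) q(1,3)])
  then show "(p, q) \<in> glue_equiv (injective_words C)"
    using p(2) q(2) equiv_glue_equiv[of "injective_words C"] by (metis symD transD)
qed

lemma realisation_homeomorphic_word_space:
  assumes "finite C"
  shows "realisation (injective_words C) homeomorphic_space top_of_set (word_space (all_words C))"
  using quotient_map_realisation quotient_map_realisation_map[OF assms]
  by (rule homeomorphic_space_of_same_fibres) (simp add: glue_equiv_class_eq realisation_map_eq_iff)

theorem proposition3p2:
  fixes C :: "'a set"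
  assumes "finite C"
  shows "\<exists>J :: nat set.
    realisation (injective_words C) homotopy_equivalent_space
      wedge_of_spheres (int (card C) - 1) J"
proof (cases "C = {}")
  case True
  have "all_words C = {[]}" using True by (auto simp: all_words_def)
  then have "word_space (all_words C) = {}" by (simp add: word_space_def cell_def)
  then have "realisation (injective_words C) homeomorphic_space (trivial_topology :: ('a list \<Rightarrow> real) topology)"
    using realisation_homeomorphic_word_space[OF assms] by simp
  then have "realisation (injective_words C) = trivial_topology"
    using homeomorphic_empty_space by blast
  then show ?thesis
    using True
    by (simp add: wedge_of_spheres_def homeomorphic_imp_homotopy_equivalent_space homeomorphic_empty_space_eq)
next
  case False
  obtain J :: "nat set" where "top_of_set (word_space (all_words C)) homotopy_equivalent_space
      wedge J (\<lambda>_. nsphere (card C - 1)) (\<lambda>_. pole)"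
    using word_space_all_words_wedge[OF assms False] by blast
  from homotopy_eqv_trans[OF homeomorphic_imp_homotopy_equivalent_space[OF
      realisation_homeomorphic_word_space[OF assms]] this]
  have "realisation (injective_words C) homotopy_equivalent_space
      wedge J (\<lambda>_. nsphere (card C - 1)) (\<lambda>_. pole)" .
  moreover have "nat (int (card C) - 1) = card C - 1" "\<not> int (card C) - 1 < 0"
    using False assms by (auto simp: card_gt_0_iff Suc_le_eq)
  ultimately show ?thesis
    unfolding wedge_of_spheres_def by auto
qed

end
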